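(* Let $V$ be a finite-dimensional vector space over a field $F$, and let $Q\colon V\to F$ and $\tilde Q\colon F\times V^*\to F$ be quadratic forms such that $$\mathrm{AO}(V,Q)^\beta=\mathrm{O}'(F\times V^*,\tilde Q)\quad\text{or}\quad \mathrm{AO}'(V,Q)^\beta=\mathrm{O}'(F\times V^*,\tilde Q).$$ Furthermore, suppose that none of the following conditions applies: (i) $\dim V=0$ and $\operatorname{Char}F=2$; (ii) $\dim V=1$ and $|F|\leq 3$; (iii) $\dim V=2$ and $|F|=2$. Then the following hold: (a) The polar form of $Q$ is non-degenerate. (b) The quadratic form $\tilde Q$ is a non-zero scalar multiple of the quadratic form $Q^\uparrow\colon F\times V^*\to F$, $Q^\uparrow(a_0,a^* )=Q\bigl(D^{-1}(a^* )\bigr)$.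
   Context: $F$ is an arbitrary (commutative) field. $V^*$ is the dual of $V$ with canonical pairing $\langle\cdot,\cdot\rangle$. For a linear map $\eta$, $\eta^{\mathrm T}\colon a^*\mapsto a^*\circ\eta$ is its transpose. For a quadratic form $Q$ on $V$: polar form $B(x,y)=Q(x+y)-Q(x)-Q(y)$; induced linear map $D\colon V\to V^*$, $D(x)=B(x,\cdot)$; radical $V^\perp=\{x\in V\mid B(x,y)=0\ \forall y\in V\}$; $B$ is non-degenerate if $V^\perp=\{0\}$ (equivalently $D$ is bijective). $\mathrm{O}(V,Q)=\{\varphi\in\mathrm{GL}(V)\mid Q\circ\varphi=Q\}$ is the orthogonal group; the weak orthogonal group $\mathrm{O}'(V,Q)$ is the subgroup of those $\varphi\in\mathrm{O}(V,Q)$ fixing every vector of $V^\perp$. The same notions apply to quadratic forms on $F\times V^*$. $\mathrm{AGL}(V)$ is the group of all affinities $\gamma\colon V\to V$, $\gamma(x)=t+\gamma_+(x)$ with (unique) $\gamma_+\in\mathrm{GL}(V)$, $t\in V$. The motion group $\mathrm{AO}(V,Q)$ (resp. weak motion group $\mathrm{AO}'(V,Q)$) consists of all $\gamma\in\mathrm{AGL}(V)$ with $\gamma_+\in\mathrm{O}(V,Q)$ (resp. $\gamma_+\in\mathrm{O}'(V,Q)$) and arbitrary $t$. $\beta\colon\mathrm{AGL}(V)\to\mathrm{GL}(F\times V^* )$, $\gamma\mapsto\gamma^\beta$, is the faithful linear representation given by $$\gamma^\beta(a_0,a^* )=\Bigl(a_0-\bigl\langle(\gamma_+^{\mathrm T})^{-1}(a^*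 ),t\bigr\rangle,\ (\gamma_+^{\mathrm T})^{-1}(a^* )\Bigr).$$ For a subgroup $G\leq\mathrm{AGL}(V)$, $G^\beta$ denotes its image under $\beta$. The form $Q^\uparrow$ in (b) is well defined because of (a). *)

theory Defs
  imports "HOL-Analysis.Product_Vector" "HOL-Library.Function_Algebras" "HOL-Library.FuncSet"
begin

text \<open>
  The vector space \<open>V\<close> is an entire type with scalar multiplication \<open>s\<close>. There is no type of
  linear forms on \<open>V\<close>, since linearity depends on \<open>s\<close>; hence \<open>F \<times> V\<^sup>*\<close> is a subspace of the
  vector space of all pairs of a scalar and a function. So that the same notions apply to
  \<open>V\<close> and to \<open>F \<times> V\<^sup>*\<close>, they are stated for a subspace \<open>W\<close> of an ambient type. A map on \<open>W\<close>
  is represented by its extensional function; this is no restriction if \<open>W = UNIV\<close>. The values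
  of a quadratic form on \<open>W\<close> outside of \<open>W\<close> are irrelevant.
\<close>

section \<open>Quadratic forms and their orthogonal groups\<close>

definition polar_form :: "('w::ab_group_add \<Rightarrow> 'f::field) \<Rightarrow> 'w \<Rightarrow> 'w \<Rightarrow> 'f" where
  "polar_form Q x y = Q (x + y) - Q x - Q y"

definition quadratic_form_on ::
    "('f::field \<Rightarrow> 'w::ab_group_add \<Rightarrow> 'w) \<Rightarrow> 'w set \<Rightarrow> ('w \<Rightarrow> 'f) \<Rightarrow> bool" where
  "quadratic_form_on s W Q \<longleftrightarrow>
     (\<forall>c. \<forall>x\<in>W. Q (s c x) = c\<^sup>2 * Q x) \<and>
     (\<forall>x\<in>W. \<forall>y\<in>W. \<forall>z\<in>W. polar_form Q (x + y) z = polar_form Q x z + polar_form Q y z) \<and>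
     (\<forall>x\<in>W. \<forall>y\<in>W. \<forall>z\<in>W. polar_form Q x (y + z) = polar_form Q x y + polar_form Q x z) \<and>
     (\<forall>c. \<forall>x\<in>W. \<forall>y\<in>W. polar_form Q (s c x) y = c * polar_form Q x y) \<and>
     (\<forall>c. \<forall>x\<in>W. \<forall>y\<in>W. polar_form Q x (s c y) = c * polar_form Q x y)"

definition radical :: "'w set \<Rightarrow> ('w::ab_group_add \<Rightarrow> 'f::field) \<Rightarrow> 'w set" where
  "radical W Q = {x \<in> W. \<forall>y\<in>W. polar_form Q x y = 0}"

definition nondegenerate_polar_form :: "'w set \<Rightarrow> ('w::ab_group_add \<Rightarrow> 'f::field) \<Rightarrow> bool" where
  "nondegenerate_polar_form W Q \<longleftrightarrow> radical W Q = {0}"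

definition general_linear ::
    "('f::field \<Rightarrow> 'w::ab_group_add \<Rightarrow> 'w) \<Rightarrow> 'w set \<Rightarrow> ('w \<Rightarrow> 'w) set" where
  "general_linear s W =
     {\<phi> \<in> extensional W. bij_betw \<phi> W W \<and>
        (\<forall>x\<in>W. \<forall>y\<in>W. \<phi> (x + y) = \<phi> x + \<phi> y) \<and> (\<forall>c. \<forall>x\<in>W. \<phi> (s c x) = s c (\<phi> x))}"

definition orthogonal_group ::
    "('f::field \<Rightarrow> 'w::ab_group_add \<Rightarrow> 'w) \<Rightarrow> 'w set \<Rightarrow> ('w \<Rightarrow> 'f) \<Rightarrow> ('w \<Rightarrow> 'w) set" where
  "orthogonal_group s W Q = {\<phi> \<in> general_linear s W. \<forall>x\<in>W. Q (\<phi> x) = Q x}"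

definition weak_orthogonal_group ::
    "('f::field \<Rightarrow> 'w::ab_group_add \<Rightarrow> 'w) \<Rightarrow> 'w set \<Rightarrow> ('w \<Rightarrow> 'f) \<Rightarrow> ('w \<Rightarrow> 'w) set" where
  "weak_orthogonal_group s W Q = {\<phi> \<in> orthogonal_group s W Q. \<forall>x\<in>radical W Q. \<phi> x = x}"

section \<open>Affinities and motions\<close>

definition affine_group ::
    "('f::field \<Rightarrow> 'v::ab_group_add \<Rightarrow> 'v) \<Rightarrow> ('v \<Rightarrow> 'v) set" where
  "affine_group s = {\<gamma>. \<exists>\<phi>\<in>general_linear s UNIV. \<exists>t. \<gamma> = (\<lambda>x. t + \<phi> x)}"

definition translation_part :: "('v::ab_group_add \<Rightarrow> 'v) \<Rightarrow> 'v" where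
  "translation_part \<gamma> = \<gamma> 0"

definition linear_part :: "('v::ab_group_add \<Rightarrow> 'v) \<Rightarrow> 'v \<Rightarrow> 'v" where
  "linear_part \<gamma> x = \<gamma> x - \<gamma> 0"

lemma general_linear_zero:
  assumes "\<phi> \<in> general_linear s UNIV"
  shows "\<phi> 0 = 0"
proof -
  have "\<phi> (0 + 0) = \<phi> 0 + \<phi> 0"
    using assms unfolding general_linear_def by blast
  then show ?thesis by simp
qed

lemma affine_parts:
  assumes "\<phi> \<in> general_linear s UNIV"
  shows "linear_part (\<lambda>x. t + \<phi> x) = \<phi>" and "translation_part (\<lambda>x. t + \<phi> x) = t"
  using general_linear_zero[OF assms] by (auto simp: linear_part_def translation_part_def)

definition motion_group ::
    "('f::field \<Rightarrow> 'v::ab_group_add \<Rightarrow> 'v) \<Rightarrow> ('v \<Rightarrow> 'f) \<Rightarrow> ('v \<Rightarrow> 'v) set" where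
  "motion_group s Q = {\<gamma> \<in> affine_group s. linear_part \<gamma> \<in> orthogonal_group s UNIV Q}"

definition weak_motion_group ::
    "('f::field \<Rightarrow> 'v::ab_group_add \<Rightarrow> 'v) \<Rightarrow> ('v \<Rightarrow> 'f) \<Rightarrow> ('v \<Rightarrow> 'v) set" where
  "weak_motion_group s Q = {\<gamma> \<in> affine_group s. linear_part \<gamma> \<in> weak_orthogonal_group s UNIV Q}"

section \<open>The dual space and the representation of the affine group\<close>

definition dual_space ::
    "('f::field \<Rightarrow> 'v::ab_group_add \<Rightarrow> 'v) \<Rightarrow> ('v \<Rightarrow> 'f) set" where
  "dual_space s = {a. Vector_Spaces.linear s (*) a}"

definition transpose_map :: "('v \<Rightarrow> 'v) \<Rightarrow> ('v \<Rightarrow> 'f) \<Rightarrow> 'v \<Rightarrow> 'f" where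
  "transpose_map \<eta> a = a \<circ> \<eta>"

definition pair_scale :: "'f::field \<Rightarrow> 'f \<times> ('v \<Rightarrow> 'f) \<Rightarrow> 'f \<times> ('v \<Rightarrow> 'f)" where
  "pair_scale = module_prod.scale (*) (\<lambda>c a x. c * a x)"

definition pair_space ::
    "('f::field \<Rightarrow> 'v::ab_group_add \<Rightarrow> 'v) \<Rightarrow> ('f \<times> ('v \<Rightarrow> 'f)) set" where
  "pair_space s = UNIV \<times> dual_space s"

definition affine_rep ::
    "('f::field \<Rightarrow> 'v::ab_group_add \<Rightarrow> 'v) \<Rightarrow> ('v \<Rightarrow> 'v) \<Rightarrow> 'f \<times> ('v \<Rightarrow> 'f) \<Rightarrow> 'f \<times> ('v \<Rightarrow> 'f)" where
  "affine_rep s \<gamma> =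
     (\<lambda>(a0, a) \<in> pair_space s.
        let b = inv_into (dual_space s) (transpose_map (linear_part \<gamma>)) a
        in (a0 - b (translation_part \<gamma>), b))"

text \<open>
  The map \<open>D\<close> from \<open>V\<close> to its dual space is \<open>polar_form Q\<close>, curried. If the polar form is
  non-degenerate, \<open>inv (polar_form Q)\<close> is \<open>D\<^sup>-\<^sup>1\<close> on the dual space; see the lemma
  \<open>bij_betw_polar_form\<close> below.
\<close>

definition lifted_form :: "('v::ab_group_add \<Rightarrow> 'f::field) \<Rightarrow> 'f \<times> ('v \<Rightarrow> 'f) \<Rightarrow> 'f" where
  "lifted_form Q = (\<lambda>(a0, a). Q (inv (polar_form Q) a))"

section \<open>Well-definedness\<close>

lemma vector_space_times: "vector_space ((*) :: 'f::field \<Rightarrow> 'f \<Rightarrow> 'f)"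
  by unfold_locales (auto simp: algebra_simps)

lemma vector_space_pair_scale:
  "vector_space (pair_scale :: 'f::field \<Rightarrow> 'f \<times> ('v \<Rightarrow> 'f) \<Rightarrow> _)"
proof -
  interpret vector_space_prod "(*) :: 'f \<Rightarrow> 'f \<Rightarrow> 'f" "\<lambda>c (a :: 'v \<Rightarrow> 'f) x. c * a x"
    by unfold_locales (auto simp: algebra_simps fun_eq_iff)
  show ?thesis
    unfolding pair_scale_def by (rule p.vector_space_axioms)
qed

lemma dual_space_iff:
  assumes "vector_space s"
  shows "a \<in> dual_space s \<longleftrightarrow> (\<forall>x y. a (x + y) = a x + a y) \<and> (\<forall>c x. a (s c x) = c * a x)"
  using assms vector_space_times
  by (auto simp: dual_space_def Vector_Spaces.linear_iff)

lemma pair_scale_apply: "pair_scale c (a0, a) = (c * a0, \<lambda>x. c * a x)"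
proof -
  interpret vector_space_prod "(*) :: 'f \<Rightarrow> 'f \<Rightarrow> 'f::field" "\<lambda>c (a :: 'v \<Rightarrow> 'f) x. c * a x"
    by unfold_locales (auto simp: algebra_simps fun_eq_iff)
  show ?thesis
    unfolding pair_scale_def by (rule scale_prod)
qed

lemma subspace_pair_space:
  assumes "vector_space s"
  shows "module.subspace pair_scale (pair_space s)"
proof -
  interpret p: vector_space pair_scale by (rule vector_space_pair_scale)
  show ?thesis
    unfolding p.subspace_def
    by (auto simp: pair_space_def dual_space_iff[OF assms] zero_prod_def pair_scale_apply
        algebra_simps)
qed

lemma bij_betw_transpose_map:
  assumes "vector_space s" "\<phi> \<in> general_linear s UNIV"
  shows "bij_betw (transpose_map \<phi>) (dual_space s) (dual_space s)"
proof (rule bij_betwI[where g = "transpose_map (inv \<phi>)"])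
  have bij: "bij \<phi>" and add: "\<And>x y. \<phi> (x + y) = \<phi> x + \<phi> y"
    and sc: "\<And>c x. \<phi> (s c x) = s c (\<phi> x)"
    using assms(2) by (auto simp: general_linear_def)
  have iadd: "inv \<phi> (x + y) = inv \<phi> x + inv \<phi> y" for x y
    by (metis add bij bij_inv_eq_iff)
  have isc: "inv \<phi> (s c x) = s c (inv \<phi> x)" for c x
    by (metis sc bij bij_inv_eq_iff)
  show "transpose_map \<phi> \<in> dual_space s \<rightarrow> dual_space s"
    using add sc by (auto simp: dual_space_iff[OF assms(1)] transpose_map_def)
  show "transpose_map (inv \<phi>) \<in> dual_space s \<rightarrow> dual_space s"
    using iadd isc by (auto simp: dual_space_iff[OF assms(1)] transpose_map_def)
  show "transpose_map (inv \<phi>) (transpose_map \<phi> a) = a" for a :: "'b \<Rightarrow> 'a"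
    using bij by (auto simp: transpose_map_def fun_eq_iff bij_def surj_f_inv_f)
  show "transpose_map \<phi> (transpose_map (inv \<phi>) a) = a" for a :: "'b \<Rightarrow> 'a"
    using bij by (auto simp: transpose_map_def fun_eq_iff bij_def)
qed

lemma affine_rep_in_general_linear:
  assumes vs: "vector_space s" and "\<gamma> \<in> affine_group s"
  shows "affine_rep s \<gamma> \<in> general_linear pair_scale (pair_space s)"
proof -
  obtain \<phi> t where phi: "\<phi> \<in> general_linear s UNIV" and gam: "\<gamma> = (\<lambda>x. t + \<phi> x)"
    using assms(2) by (auto simp: affine_group_def)
  define T where "T = inv_into (dual_space s) (transpose_map \<phi> :: _ \<Rightarrow> _ \<Rightarrow> 'a)"
  note bij = bij_betw_transpose_map[OF vs phi]
  have bijT: "bij_betw T (dual_space s) (dual_space s)"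
    unfolding T_def by (rule bij_betw_inv_into[OF bij])
  have Tin: "T a \<in> dual_space s" if "a \<in> dual_space s" for a
    using bijT that by (auto simp: bij_betw_def)
  have Tinv: "transpose_map \<phi> (T a) = a" if "a \<in> dual_space s" for a
    unfolding T_def using bij that by (rule bij_betw_inv_into_right)
  have TT: "T (transpose_map \<phi> a) = a" if "a \<in> dual_space s" for a
    unfolding T_def using bij that by (rule bij_betw_inv_into_left)
  have Min: "transpose_map \<phi> a \<in> dual_space s" if "a \<in> dual_space s" for a
    using bij that by (auto simp: bij_betw_def)
  have dadd: "a + b \<in> dual_space s" if "a \<in> dual_space s" "b \<in> dual_space s" for a b
    using that by (auto simp: dual_space_iff[OF vs] algebra_simps)
  have dsc: "(\<lambda>x. c * a x) \<in> dual_space s" if "a \<in> dual_space s" for a c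
    using that by (auto simp: dual_space_iff[OF vs] algebra_simps)
  have Tadd: "T (a + b) = T a + T b" if "a \<in> dual_space s" "b \<in> dual_space s" for a b
  proof -
    have "transpose_map \<phi> (T a + T b) = transpose_map \<phi> (T a) + transpose_map \<phi> (T b)"
      by (auto simp: transpose_map_def)
    then show ?thesis
      using TT[OF dadd[OF Tin[OF that(1)] Tin[OF that(2)]]] Tinv[OF that(1)] Tinv[OF that(2)]
      by simp
  qed
  have Tsc: "T (\<lambda>x. c * a x) = (\<lambda>x. c * T a x)" if "a \<in> dual_space s" for a c
  proof -
    have "transpose_map \<phi> (\<lambda>x. c * T a x) = (\<lambda>x. c * transpose_map \<phi> (T a) x)"
      by (auto simp: transpose_map_def)
    then show ?thesis
      using TT[OF dsc[OF Tin[OF that]]] Tinv[OF that] by metis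
  qed
  have rep: "affine_rep s \<gamma> (a0, a) = (a0 - T a t, T a)" if "a \<in> dual_space s" for a0 a
    using that affine_parts[OF phi, of t]
    by (auto simp: affine_rep_def gam T_def pair_space_def Let_def)
  have "bij_betw (affine_rep s \<gamma>) (pair_space s) (pair_space s)"
    by (rule bij_betwI[where g = "\<lambda>(a0, a). (a0 + a t, transpose_map \<phi> a)"])
      (auto simp: pair_space_def rep Tin Min TT Tinv)
  moreover have "affine_rep s \<gamma> \<in> extensional (pair_space s)"
    by (simp add: affine_rep_def)
  ultimately show ?thesis
    by (auto simp: general_linear_def pair_space_def rep Tadd Tsc dadd dsc pair_scale_apply
        algebra_simps)
qed

lemma bij_betw_polar_form:
  assumes fd: "finite_dimensional_vector_space s Basis"
    and q: "quadratic_form_on s UNIV Q" and nd: "nondegenerate_polar_form UNIV Q"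
  shows "bij_betw (polar_form Q) UNIV (dual_space s)"
proof -
  interpret V: finite_dimensional_vector_space s Basis by fact
  interpret VV: finite_dimensional_vector_space_pair s Basis s Basis ..
  have addl: "polar_form Q (x + y) z = polar_form Q x z + polar_form Q y z"
    and addr: "polar_form Q x (y + z) = polar_form Q x y + polar_form Q x z"
    and scl: "polar_form Q (s c x) y = c * polar_form Q x y"
    and scr: "polar_form Q x (s c y) = c * polar_form Q x y" for c x y z
    using q by (auto simp: quadratic_form_on_def)
  have rad: "x = 0" if "\<And>y. polar_form Q x y = 0" for x
    using nd that by (auto simp: nondegenerate_polar_form_def radical_def)
  have dual: "polar_form Q x \<in> dual_space s" for x
    using addr scr by (auto simp: dual_space_iff[OF V.vector_space_axioms])
  have eqD: "a = b" if "a \<in> dual_space s" "b \<in> dual_space s" "\<And>e. e \<in> Basis \<Longrightarrow> a e = b e" for a b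
  proof -
    interpret P: vector_space_pair s "(*)"
      by (intro vector_space_pair.intro V.vector_space_axioms vector_space_times)
    show ?thesis
      using P.linear_eq_on[of a b _ Basis] that V.span_Basis by (auto simp: dual_space_def)
  qed
  define L where "L x = (\<Sum>e\<in>Basis. s (polar_form Q x e) e)" for x
  have linL: "Vector_Spaces.linear s s L"
    unfolding Vector_Spaces.linear_iff L_def
    by (auto simp: V.vector_space_axioms addl scl V.scale_left_distrib sum.distrib V.scale_sum_right)
  have coeff: "u e = v e" if "(\<Sum>e\<in>Basis. s (u e) e) = (\<Sum>e\<in>Basis. s (v e) e)" "e \<in> Basis" for u v e
  proof -
    have "(\<Sum>e\<in>Basis. s (u e - v e) e) = 0"
      using that(1) by (simp add: V.scale_left_diff_distrib sum_subtractf)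
    then have "u e - v e = 0"
      using V.independentD[OF V.independent_Basis V.finite_Basis order_refl, of "\<lambda>e. u e - v e"] that(2)
      by blast
    then show ?thesis by simp
  qed
  have zero: "(0 :: 'b \<Rightarrow> 'a) \<in> dual_space s"
    by (auto simp: dual_space_iff[OF V.vector_space_axioms])
  have "x = 0" if "L x = 0" for x
  proof -
    have "polar_form Q x = 0"
      using coeff[of "polar_form Q x" "\<lambda>_. 0"] that by (intro eqD dual zero) (auto simp: L_def)
    then show ?thesis using rad by simp
  qed
  then have injL: "inj L"
    using VV.linear_inj_iff_eq_0[OF linL] by blast
  have surjL: "surj L"
    using V.linear_inj_imp_surj[OF linL injL] .
  have "inj (polar_form Q)"
    using injL by (auto simp: inj_def L_def)
  moreover have "a \<in> range (polar_form Q)" if "a \<in> dual_space s" for a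
  proof -
    obtain x where "L x = (\<Sum>e\<in>Basis. s (a e) e)"
      using surjL by (metis surjD)
    then have "a = polar_form Q x"
      using coeff[of "polar_form Q x" a] by (intro eqD that dual) (auto simp: L_def)
    then show ?thesis by blast
  qed
  ultimately show ?thesis
    using dual by (auto simp: bij_betw_def)
qed

end

theory Submission
  imports Defs
begin

text \<open>
  Let \<open>e = (1, 0)\<close>, and let \<open>dim V \<ge> 1\<close>; a point needs only the isometry \<open>- 1\<close> of the line \<open>F e\<close>
  (\<open>form_on_pair_space_over_point\<close>). The translation by \<open>t\<close> acts on \<open>F \<times> V\<^sup>*\<close> as
  \<open>(a0, a) \<mapsto> (a0 - a t, a)\<close> and is an isometry of \<open>Qt\<close> that fixes the radical of \<open>Qt\<close>. For \<open>a \<noteq> 0\<close>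
  the scalar \<open>a t\<close> takes every value, so \<open>Qt (a0, a)\<close> depends only on \<open>a\<close>. This forces \<open>Qt e = 0\<close>,
  unless \<open>V\<close> is a line over the field with two elements, and extends the independence of \<open>a0\<close> to
  \<open>a = 0\<close> (\<open>Qt_eq_dual_form\<close>). Since all \<open>a t\<close> vanish if \<open>(a0, a)\<close> is in the radical, the radical
  is the line spanned by \<open>e\<close> (\<open>radical_Qt\<close>). So \<open>Qt\<close> is a form \<open>R\<close> on \<open>V\<^sup>*\<close> with non-degenerate polar
  form. This polar form identifies \<open>V\<^sup>*\<close> with \<open>V\<close> and carries \<open>R\<close> to a form \<open>P\<close> on \<open>V\<close> with
  \<open>R = P \<circ> D\<^sub>P\<^sup>-\<^sup>1\<close> (\<open>form_on_dual_from_polar_form\<close>). The hypothesis on the motion groups then says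
  that \<open>O(V,P)\<close> is \<open>O(V,Q)\<close> or \<open>O'(V,Q)\<close> (\<open>orthogonal_group_via_representation\<close>), and the claim
  becomes \<open>Q = c P\<close> with \<open>c \<noteq> 0\<close> (\<open>forms_proportional\<close>), because scaling a form by \<open>c\<close> scales its
  lifted form by \<open>1 / c\<close>.

  In either case \<open>O'(V,Q) \<subseteq> O(V,P) \<subseteq> O(V,Q)\<close>. This is exploited with maps \<open>x \<mapsto> x + f(x) a\<close>: if such
  a map with \<open>f \<noteq> 0\<close> preserves a form, it determines \<open>B(\<cdot>, a)\<close> as \<open>- f\<close> times the value of the form
  at \<open>a\<close> (\<open>rank_one_preserving_form\<close>). Reflections of \<open>P\<close> preserve \<open>Q\<close>, hence
  \<open>B\<^sub>Q(\<cdot>, a) P(a) = B\<^sub>P(\<cdot>, a) Q(a)\<close> whenever \<open>P(a) \<noteq> 0\<close>; reflections of \<open>Q\<close> preserve \<open>P\<close>, which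
  gives the same equation whenever \<open>Q(a) \<noteq> 0\<close> and \<open>a\<close> is not in the radical of \<open>Q\<close>.

  If \<open>Q\<close> has radical \<open>0\<close>, the two equations show that \<open>P\<close> and \<open>Q\<close> have the same isotropic vectors
  and that \<open>Q / P\<close> takes equal values at any two anisotropic vectors: if these are orthogonal, look
  at their sum, on which both forms vanish or neither does. This step works over every field. It
  remains to exclude a non-zero radical. Suppose first that the polar form of \<open>Q\<close> is non-zero. The
  transvections of \<open>Q\<close> along a radical vector \<open>r \<noteq> 0\<close> with \<open>Q(r) = 0\<close> cannot all preserve \<open>P\<close>; so
  \<open>Q\<close> is anisotropic on its radical, whence the characteristic is 2 and all \<open>P\<close>-anisotropic vectors
  lie in a hyperplane, which happens only in a plane over the field with two elements. If the polar
  form of \<open>Q\<close> is zero, then \<open>O'(V,Q)\<close> is trivial, so \<open>O(V,P) = O(V,Q)\<close>; the latter group is so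
  large that \<open>V\<close> and \<open>F\<close> must be small. These are the excluded cases.
\<close>

section \<open>Quadratic forms and maps of rank one\<close>

locale quadratic_space = finite_dimensional_vector_space scale Basis
  for scale :: "'f::field \<Rightarrow> 'v::ab_group_add \<Rightarrow> 'v" (infixr \<open>*s\<close> 75) and Basis :: "'v set" +
  fixes Q :: "'v \<Rightarrow> 'f"
  assumes quadratic: "quadratic_form_on scale UNIV Q"
begin

abbreviation B :: "'v \<Rightarrow> 'v \<Rightarrow> 'f" where "B \<equiv> polar_form Q"

lemma form_scale: "Q (c *s x) = c\<^sup>2 * Q x"
  and polar_add_left: "B (x + y) z = B x z + B y z"
  and polar_add_right: "B x (y + z) = B x y + B x z"
  and polar_scale_left: "B (c *s x) y = c * B x y"
  and polar_scale_right: "B x (c *s y) = c * B x y"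
  using quadratic by (auto simp: quadratic_form_on_def)

lemma polar_sym: "B x y = B y x"
  by (simp add: polar_form_def algebra_simps)

lemma form_add: "Q (x + y) = Q x + Q y + B x y"
  by (simp add: polar_form_def)

lemma form_zero: "Q 0 = 0"
  using form_scale[of 0 0] by simp

lemma polar_zero_left: "B 0 x = 0"
  by (simp add: polar_form_def form_zero)

lemma polar_diff_left: "B (x - y) z = B x z - B y z"
  using polar_add_left[of "x - y" y z] by simp

lemma polar_self: "B x x = 2 * Q x"
proof -
  have "Q (x + x) = 4 * Q x"
    using form_scale[of 2 x] scale_left_distrib[of 1 1 x] by simp
  then show ?thesis by (simp add: polar_form_def)
qed

lemma radical_iff: "r \<in> radical UNIV Q \<longleftrightarrow> (\<forall>x. B r x = 0)"
  by (simp add: radical_def)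

lemma form_rank_one: "Q (x + c *s a) = Q x + c * (c * Q a + B x a)"
  by (simp add: form_add form_scale polar_scale_right power2_eq_square algebra_simps)

text \<open>
  Comparing values gives \<open>f x (f x * Q a + B x a) = 0\<close>, which settles all \<open>x\<close> with \<open>f x \<noteq> 0\<close>. These
  span the space: any other \<open>x\<close> is the difference of \<open>x + z\<close> and \<open>z\<close>. This lemma is the source of
  all relations between the two forms below.
\<close>

lemma rank_one_preserving_form:
  assumes add: "\<And>x y. f (x + y) = f x + f y"
    and pres: "\<And>x. Q (x + f x *s a) = Q x" and "f z \<noteq> 0"
  shows "B x a = - f x * Q a"
proof -
  have nz: "B x a = - f x * Q a" if "f x \<noteq> 0" for x
    using pres[of x] that by (simp add: form_rank_one eq_neg_iff_add_eq_0 add.commute)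
  show ?thesis
  proof (cases "f x = 0")
    case True
    have "B (x + z) a = - f (x + z) * Q a"
      using True \<open>f z \<noteq> 0\<close> add by (intro nz) simp
    then show ?thesis
      using nz[OF \<open>f z \<noteq> 0\<close>] True add by (simp add: polar_add_left)
  qed (rule nz)
qed

end

context vector_space
begin

text \<open>
  The value of \<open>f\<close> is multiplied by \<open>1 + f a\<close>, so the inverse map subtracts
  \<open>(f y / (1 + f a)) a\<close> from \<open>y\<close>.
\<close>

lemma rank_one_in_general_linear:
  assumes add: "\<And>x y. f (x + y) = f x + f y" and sc: "\<And>c x. f (c *s x) = c * f x"
    and "f a \<noteq> - 1"
  shows "(\<lambda>x. x + f x *s a) \<in> general_linear scale UNIV"
proof -
  have nz: "1 + f a \<noteq> 0"
    using assms(3) by (simp add: eq_neg_iff_add_eq_0 add.commute)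
  define g where "g y = y - (f y / (1 + f a)) *s a" for y
  have g: "g (x + f x *s a) = x" for x
  proof -
    have "f (x + f x *s a) / (1 + f a) = f x"
      using nz by (simp add: add sc field_simps)
    then show ?thesis by (simp add: g_def)
  qed
  have "f (g y) = f y / (1 + f a)" for y
  proof -
    have "f y = f (g y) + f y / (1 + f a) * f a"
      using add[of "g y" "(f y / (1 + f a)) *s a"] sc by (simp add: g_def)
    then show ?thesis
      using nz by (simp add: field_simps)
  qed
  then have "g y + f (g y) *s a = y" for y
    by (simp add: g_def)
  then have "bij (\<lambda>x. x + f x *s a)"
    using g by (intro bij_betwI[where g = g]) auto
  then show ?thesis
    by (auto simp: general_linear_def add sc algebra_simps)
qed

end

context quadratic_space
begin

lemma rank_one_in_weak_orthogonal_group: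
  assumes "\<And>x y. f (x + y) = f x + f y" "\<And>c x. f (c *s x) = c * f x" "f a \<noteq> - 1"
    and "\<And>x. f x * (f x * Q a + B x a) = 0" "\<And>x. x \<in> radical UNIV Q \<Longrightarrow> f x = 0"
  shows "(\<lambda>x. x + f x *s a) \<in> weak_orthogonal_group scale UNIV Q"
  using rank_one_in_general_linear[OF assms(1-3)] assms(4,5)
  by (simp add: weak_orthogonal_group_def orthogonal_group_def form_rank_one)

lemma reflection_in_weak_orthogonal_group:
  assumes "Q a \<noteq> 0"
  shows "(\<lambda>x. x + (- B x a / Q a) *s a) \<in> weak_orthogonal_group scale UNIV Q"
proof -
  \<comment> \<open>Here \<open>f a = - 2\<close>, which must differ from \<open>- 1\<close>.\<close>
  have "(2 :: 'f) \<noteq> 1"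
    by (metis add_cancel_right_right one_add_one zero_neq_one)
  then show ?thesis
    using assms
    by (intro rank_one_in_weak_orthogonal_group)
      (auto simp: polar_add_left polar_scale_left polar_self radical_def field_simps)
qed

lemma anisotropic_vector_exists:
  assumes "B x y \<noteq> 0"
  obtains a where "Q a \<noteq> 0"
  using assms by (metis diff_self polar_form_def)

end

section \<open>Forms with the same isometries\<close>

text \<open>
  The situation on \<open>V\<close> after \<open>Qt\<close> has been carried over to the form \<open>P\<close>. The two cases of
  \<open>isometries\<close> correspond to the motion group and to the weak motion group of \<open>Q\<close>.
\<close>

locale forms_with_same_isometries =
  P: quadratic_space scale Basis P + Q: quadratic_space scale Basis Q
  for scale :: "'f::field \<Rightarrow> 'v::ab_group_add \<Rightarrow> 'v" (infixr \<open>*s\<close> 75)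
    and Basis :: "'v set" and P Q :: "'v \<Rightarrow> 'f" +
  assumes nondegenerate: "nondegenerate_polar_form UNIV P"
    and isometries: "orthogonal_group scale UNIV P = orthogonal_group scale UNIV Q \<or>
      orthogonal_group scale UNIV P = weak_orthogonal_group scale UNIV Q"
    and not_point: "P.dim UNIV \<noteq> 0"
    and not_small_line: "\<not> (P.dim UNIV = 1 \<and> finite (UNIV :: 'f set) \<and> card (UNIV :: 'f set) \<le> 3)"
    and not_small_plane: "\<not> (P.dim UNIV = 2 \<and> card (UNIV :: 'f set) = 2)"
begin

lemma weak_isometry_preserves_P:
  assumes "\<phi> \<in> weak_orthogonal_group scale UNIV Q"
  shows "P (\<phi> x) = P x"
proof -
  have "\<phi> \<in> orthogonal_group scale UNIV P"
    using assms isometries by (auto simp: weak_orthogonal_group_def)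
  then show ?thesis by (simp add: orthogonal_group_def)
qed

lemma isometry_preserves_Q:
  assumes "\<phi> \<in> weak_orthogonal_group scale UNIV P"
  shows "Q (\<phi> x) = Q x"
proof -
  have "\<phi> \<in> orthogonal_group scale UNIV Q"
    using assms isometries by (auto simp: weak_orthogonal_group_def)
  then show ?thesis by (simp add: orthogonal_group_def)
qed

lemma P_nondegenerate:
  assumes "x \<noteq> 0"
  obtains y where "P.B y x \<noteq> 0"
proof -
  have "x \<notin> radical UNIV P"
    using nondegenerate assms by (auto simp: nondegenerate_polar_form_def)
  then show thesis
    using that P.polar_sym by (auto simp: P.radical_iff)
qed

text \<open>
  This lemma and the next one are the form in which the excluded cases are used: a small field
  together with few generators of the space is contradictory.
\<close>

lemma not_generated_by_one:
  assumes "finite (UNIV :: 'f set)" "card (UNIV :: 'f set) \<le> 3"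
  obtains x where "\<And>c. x \<noteq> c *s v"
proof (rule ccontr)
  assume "\<not> thesis"
  then have "\<exists>c. x = c *s v" for x
    using that by blast
  then have "UNIV \<subseteq> P.span {v}"
    by (auto simp: P.span_singleton)
  then have "P.dim UNIV \<le> 1"
    using P.dim_le_card[of UNIV "{v}"] by simp
  then show False
    using not_point not_small_line assms by linarith
qed

lemma not_generated_by_two:
  assumes "(UNIV :: 'f set) = {0, 1}"
  obtains x where "\<And>c d. x \<noteq> c *s v + d *s w"
proof (rule ccontr)
  assume "\<not> thesis"
  then have "\<exists>c d. x = c *s v + d *s w" for x
    using that by blast
  then have "UNIV \<subseteq> P.span {v, w}"
    by (auto simp: P.span_insert algebra_simps)
  then have "P.dim UNIV \<le> card {v, w}"
    by (intro P.dim_le_card) auto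
  also have "\<dots> \<le> 2"
    by (simp add: card_insert_if)
  finally have "P.dim UNIV = 1 \<or> P.dim UNIV = 2"
    using not_point by linarith
  moreover have "card (UNIV :: 'f set) = 2" "finite (UNIV :: 'f set)"
    unfolding assms by auto
  ultimately show False
    using not_small_line not_small_plane by auto
qed

lemma anisotropic_exists:
  obtains a where "P a \<noteq> 0"
proof -
  have "\<not> (UNIV :: 'v set) \<subseteq> {0}"
    using not_point by (simp only: P.dim_eq_0 not_False_eq_True)
  then obtain x :: 'v where "x \<noteq> 0"
    by auto
  then obtain y where "P.B y x \<noteq> 0"
    by (rule P_nondegenerate)
  then show thesis
    using that by (rule P.anisotropic_vector_exists)
qed

text \<open>
  The reflection of \<open>P\<close> in \<open>a\<close> preserves \<open>Q\<close>, and it is a map of rank one in the sense above, with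
  \<open>f = - B\<^sub>P(\<cdot>, a) / P a\<close>.
\<close>

lemma polar_proportional:
  assumes "P a \<noteq> 0"
  shows "Q.B x a * P a = P.B x a * Q a"
proof -
  have "a \<noteq> 0"
    using assms P.form_zero by auto
  then obtain z where "P.B z a \<noteq> 0"
    by (rule P_nondegenerate)
  then have "Q.B x a = - (- P.B x a / P a) * Q a"
    using assms isometry_preserves_Q[OF P.reflection_in_weak_orthogonal_group[OF assms]]
    by (intro Q.rank_one_preserving_form[where z = z])
      (auto simp: P.polar_add_left field_simps)
  then show ?thesis
    using assms by simp
qed

text \<open>
  The reflection of \<open>Q\<close> in \<open>a\<close> fixes the radical of \<open>Q\<close>, so it preserves \<open>P\<close>. It is not the identity
  because \<open>a\<close> is not in the radical.
\<close>

lemma polar_proportional':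
  assumes "Q a \<noteq> 0" "a \<notin> radical UNIV Q"
  shows "Q.B x a * P a = P.B x a * Q a"
proof -
  obtain z where "Q.B z a \<noteq> 0"
    using assms(2) Q.polar_sym by (auto simp: Q.radical_iff)
  then have "P.B x a = - (- Q.B x a / Q a) * P a"
    using assms weak_isometry_preserves_P[OF Q.reflection_in_weak_orthogonal_group[OF assms(1)]]
    by (intro P.rank_one_preserving_form[where z = z])
      (auto simp: Q.polar_add_left field_simps)
  then show ?thesis
    using assms by simp
qed

text \<open>
  The transvections \<open>x \<mapsto> x + f(x) r\<close>, where \<open>f = c B\<^sub>Q(\<cdot>, v)\<close> vanishes on the radical of \<open>Q\<close>, are
  weak isometries of \<open>Q\<close> and therefore preserve \<open>P\<close>.
\<close>

lemma singular_radical_vector: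
  assumes "r \<in> radical UNIV Q" "Q r = 0" and f_nonzero: "Q.B u v \<noteq> 0" "c \<noteq> 0"
  shows "P.B x r = - c * Q.B x v * P r"
proof -
  define f where "f x = c * Q.B x v" for x
  have add: "f (x + y) = f x + f y" for x y
    by (simp add: f_def Q.polar_add_left algebra_simps)
  have "(\<lambda>x. x + f x *s r) \<in> weak_orthogonal_group scale UNIV Q"
    using assms add
    by (intro Q.rank_one_in_weak_orthogonal_group)
      (auto simp: f_def Q.polar_scale_left Q.radical_iff Q.polar_sym[of _ r])
  then have "P.B x r = - f x * P r"
    using add f_nonzero weak_isometry_preserves_P
    by (intro P.rank_one_preserving_form[where z = u]) (auto simp: f_def)
  then show ?thesis by (simp add: f_def)
qed

text \<open>
  If \<open>Q r = 0\<close>, then every functional \<open>c B\<^sub>Q(\<cdot>, v) \<noteq> 0\<close> equals the fixed functional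
  \<open>- B\<^sub>P(\<cdot>, r) / P r\<close>. But these functionals are not all equal: in characteristic other than 2 take
  \<open>f\<close> and \<open>- f\<close>, and in characteristic 2 compare \<open>B\<^sub>Q(\<cdot>, v)\<close> and \<open>B\<^sub>Q(\<cdot>, u)\<close> at \<open>u\<close>.
\<close>

lemma radical_anisotropic:
  assumes "Q.B u v \<noteq> 0" "r \<in> radical UNIV Q" "r \<noteq> 0"
  shows "Q r \<noteq> 0"
proof
  assume "Q r = 0"
  note sing = singular_radical_vector[OF assms(2) this]
  have vu: "Q.B v u \<noteq> 0"
    using assms(1) Q.polar_sym by simp
  obtain z where z: "P.B z r \<noteq> 0"
    using P_nondegenerate[OF assms(3)] .
  then have "P r \<noteq> 0"
    using sing[OF assms(1), of 1 z] by auto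
  then have "Q.B u v = - Q.B u v"
    using sing[OF assms(1), of 1 u] sing[OF assms(1), of "- 1" u] by simp
  moreover have "Q.B u v = Q.B u u"
    using sing[OF assms(1), of 1 u] sing[OF vu, of 1 u] \<open>P r \<noteq> 0\<close> by simp
  ultimately have "2 * Q.B u v = 0" "Q.B u v = 2 * Q u"
    using Q.polar_self by (simp_all only: eq_neg_iff_add_eq_0 mult_2)
  then show False
    using assms(1) by (metis mult_eq_0_iff mult_zero_left)
qed

text \<open>
  Suppose that \<open>P\<close> vanishes outside of the hyperplane \<open>r\<^sup>\<bottom>\<close>, and let \<open>x\<close> be outside. In
  characteristic 2 the line \<open>x + F r\<close> also lies outside, and the values of \<open>P\<close> on it force
  \<open>F = {0, 1}\<close>. The values on \<open>x + r\<^sup>\<bottom>\<close> show that \<open>P\<close> is additive on \<open>r\<^sup>\<bottom>\<close>, so \<open>r\<^sup>\<bottom>\<close> is totally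
  orthogonal to itself. Hence it is spanned by \<open>r\<close>, and \<open>r\<close> and \<open>x\<close> span the space.
\<close>

lemma anisotropic_not_orthogonal:
  assumes "r \<noteq> 0" "(2 :: 'f) = 0"
  obtains a where "P a \<noteq> 0" "P.B a r \<noteq> 0"
proof (rule ccontr)
  assume "\<not> thesis"
  then have iso: "P x = 0" if "P.B x r \<noteq> 0" for x
    using that \<open>\<And>a. P a \<noteq> 0 \<Longrightarrow> P.B a r \<noteq> 0 \<Longrightarrow> thesis\<close> by blast
  obtain x where x: "P.B x r \<noteq> 0"
    using P_nondegenerate[OF assms(1)] .
  have rr: "P.B r r = 0"
    by (simp add: P.polar_self assms(2))
  have on_line: "c * P r = - P.B x r" if "c \<noteq> 0" for c :: 'f
    using iso[of "x + c *s r"] x that iso[OF x]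
    by (simp add: P.form_rank_one P.polar_add_left P.polar_scale_left rr eq_neg_iff_add_eq_0)
  then have "P r = - P.B x r"
    using on_line[of 1] by simp
  then have one: "c = 1" if "c \<noteq> 0" for c :: 'f
    using on_line[OF that] x by simp
  then have two: "(UNIV :: 'f set) = {0, 1}"
    using one by auto
  have P_perp: "P y = - P.B x y" if "P.B y r = 0" for y
    using iso[of "x + y"] x iso[OF x] that
    by (simp add: P.form_add P.polar_add_left eq_neg_iff_add_eq_0)
  have perp: "P.B y z = 0" if "P.B y r = 0" "P.B z r = 0" for y z
    using P_perp[of "y + z"] P_perp[OF that(1)] P_perp[OF that(2)] that
    by (simp add: P.form_add P.polar_add_left P.polar_add_right)
  have perp_x: "y = 0" if "P.B y r = 0" "P.B y x = 0" for y
  proof (rule ccontr)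
    assume "y \<noteq> 0"
    then obtain w where w: "P.B w y \<noteq> 0"
      by (rule P_nondegenerate)
    define d where "d = P.B w r / P.B x r"
    have "P.B (w - d *s x) r = 0"
      using x by (simp add: d_def P.polar_diff_left P.polar_scale_left)
    then have "P.B (w - d *s x) y = 0"
      using that(1) by (rule perp)
    then show False
      using w that(2) P.polar_sym[of x y]
      by (simp add: P.polar_diff_left P.polar_scale_left)
  qed
  have "\<exists>c d. w = c *s r + d *s x" for w
  proof -
    define d where "d = P.B w r / P.B x r"
    define c where "c = P.B (w - d *s x) x / P.B r x"
    have rx: "P.B r x \<noteq> 0"
      using x P.polar_sym by simp
    have "w - d *s x - c *s r = 0"
    proof (rule perp_x)
      show "P.B (w - d *s x - c *s r) r = 0"
        using x rr by (simp add: d_def P.polar_diff_left P.polar_scale_left)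
      show "P.B (w - d *s x - c *s r) x = 0"
        using rx P.polar_diff_left[of "w - d *s x" "c *s r" x] P.polar_scale_left[of c r x]
        by (simp add: c_def)
    qed
    then have "w = c *s r + d *s x"
      by (simp add: algebra_simps)
    then show ?thesis by blast
  qed
  then show False
    using not_generated_by_two[OF two, of r x] by metis
qed

text \<open>
  A radical vector \<open>r \<noteq> 0\<close> has \<open>Q r \<noteq> 0\<close> but \<open>2 Q r = B\<^sub>Q(r, r) = 0\<close>, so the characteristic is 2
  and some \<open>a\<close> with \<open>P a \<noteq> 0\<close> is not \<open>P\<close>-orthogonal to \<open>r\<close>. Since \<open>B\<^sub>Q(r, a) = 0\<close>, proportionality
  at \<open>a\<close> gives \<open>Q a = 0\<close> and then puts \<open>a\<close> itself into the radical, where \<open>Q\<close> is anisotropic.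
\<close>

lemma radical_trivial:
  assumes "Q.B u v \<noteq> 0"
  shows "radical UNIV Q = {0}"
proof -
  have "r = 0" if r: "r \<in> radical UNIV Q" for r
  proof (rule ccontr)
    assume "r \<noteq> 0"
    have "2 * Q r = 0"
      using r Q.polar_self[of r] by (simp add: Q.radical_iff)
    then have "(2 :: 'f) = 0"
      using radical_anisotropic[OF assms r \<open>r \<noteq> 0\<close>] by simp
    then obtain a where a: "P a \<noteq> 0" "P.B a r \<noteq> 0"
      using anisotropic_not_orthogonal[OF \<open>r \<noteq> 0\<close>] by blast
    have ratio: "Q.B x a * P a = P.B x a * Q a" for x
      using polar_proportional[OF a(1)] .
    have "Q a = 0"
      using ratio[of r] r a P.polar_sym[of r a] by (simp add: Q.radical_iff)
    then have "a \<in> radical UNIV Q"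
      using ratio a(1) Q.polar_sym[of a] by (simp add: Q.radical_iff)
    moreover have "a \<noteq> 0"
      using a(1) P.form_zero by auto
    ultimately show False
      using radical_anisotropic[OF assms] \<open>Q a = 0\<close> by blast
  qed
  moreover have "0 \<in> radical UNIV Q"
    by (simp add: Q.radical_iff Q.polar_zero_left)
  ultimately show ?thesis by blast
qed

text \<open>
  If the polar form of \<open>Q\<close> vanishes, then \<open>O'(V,Q)\<close> is trivial while \<open>O(V,P)\<close> contains reflections,
  so \<open>O(V,P) = O(V,Q)\<close>. A vector \<open>a\<close> with \<open>P a \<noteq> 0\<close> has \<open>Q a = 0\<close>, so every invertible map
  \<open>x \<mapsto> x + B\<^sub>P(x, v) a\<close> preserves \<open>Q\<close> and hence \<open>P\<close>. This leaves few possibilities for \<open>v\<close>: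
  either \<open>v\<close> is \<open>0\<close> or \<open>k = - a / P a\<close> (the vector of the reflection in \<open>a\<close>), or
  \<open>B\<^sub>P(a, v) = - 1\<close> and the map is singular. Applied to a line not orthogonal to \<open>a\<close> this bounds
  \<open>F\<close> by three elements; applied to \<open>a\<^sup>\<bottom>\<close> it shows that \<open>a\<^sup>\<bottom>\<close> has at most two elements, so that
  the dimension is at most 2, and \<open>F\<close> has two elements if it is 2.
\<close>

lemma polar_nonzero: "\<exists>u v. Q.B u v \<noteq> 0"
proof (rule ccontr)
  assume "\<not> ?thesis"
  then have B0: "Q.B x y = 0" for x y
    by blast
  obtain a where a: "P a \<noteq> 0"
    by (rule anisotropic_exists)
  then have "a \<noteq> 0"
    using P.form_zero by auto
  then obtain w where w: "P.B w a \<noteq> 0"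
    by (rule P_nondegenerate)
  have "Q a = 0"
    using polar_proportional[OF a, of w] w B0 by simp
  have refl: "(\<lambda>x. x + (- P.B x a / P a) *s a) \<in> orthogonal_group scale UNIV P"
    using P.reflection_in_weak_orthogonal_group[OF a] by (simp add: weak_orthogonal_group_def)
  have "w + (- P.B w a / P a) *s a \<noteq> w"
    using w a \<open>a \<noteq> 0\<close> by simp
  moreover have "w \<in> radical UNIV Q"
    using B0 by (simp add: Q.radical_iff)
  ultimately have "(\<lambda>x. x + (- P.B x a / P a) *s a) \<notin> weak_orthogonal_group scale UNIV Q"
    unfolding weak_orthogonal_group_def by blast
  then have eq: "orthogonal_group scale UNIV P = orthogonal_group scale UNIV Q"
    using isometries refl by metis
  define k where "k = (- 1 / P a) *s a"
  have "k \<noteq> 0"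
    using a \<open>a \<noteq> 0\<close> by (simp add: k_def)
  have few: "v = 0 \<or> v = k \<or> P.B a v = - 1" for v
  proof (rule ccontr)
    assume asm: "\<not> ?thesis"
    then obtain z where z: "P.B z v \<noteq> 0"
      using P_nondegenerate by blast
    have "(\<lambda>x. x + P.B x v *s a) \<in> general_linear scale UNIV"
      using asm by (intro P.rank_one_in_general_linear) (auto simp: P.polar_add_left P.polar_scale_left)
    then have "(\<lambda>x. x + P.B x v *s a) \<in> orthogonal_group scale UNIV P"
      unfolding eq using B0 \<open>Q a = 0\<close> by (simp add: orthogonal_group_def Q.form_rank_one)
    then have "P.B x a = - P.B x v * P a" for x
      using z by (intro P.rank_one_preserving_form) (auto simp: P.polar_add_left orthogonal_group_def)
    moreover have "P.B k x = - P.B x a / P a" for x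
      unfolding k_def P.polar_scale_left by (simp add: P.polar_sym)
    ultimately have "P.B x (v - k) = 0" for x
      using a P.polar_diff_left[of v k x] P.polar_sym[of v x] P.polar_sym[of "v - k" x]
      by simp
    then show False
      using asm P_nondegenerate[of "v - k"] by auto
  qed
  define q where "q = - 1 / P.B w a"
  define p where "p = (SOME c. c *s w = k)"
  have "w \<noteq> 0"
    using w P.polar_zero_left by auto
  have "c \<in> {0, p, q}" for c :: 'f
  proof -
    consider "c = 0" | "c *s w = k" | "c * P.B w a = - 1"
      using few[of "c *s w"] \<open>w \<noteq> 0\<close> by (auto simp: P.polar_sym[of a] P.polar_scale_left)
    then show ?thesis
    proof cases
      case 2
      then have "p *s w = k"
        unfolding p_def by (rule someI)
      then have "p = c"
        using 2 \<open>w \<noteq> 0\<close> P.scale_right_imp_eq by metis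
      then show ?thesis by simp
    next
      case 3
      then show ?thesis
        using w by (simp add: q_def field_simps)
    qed simp
  qed
  then have sub: "(UNIV :: 'f set) \<subseteq> {0, p, q}"
    by blast
  have "finite (UNIV :: 'f set)"
    using sub finite_subset by blast
  moreover have "card (UNIV :: 'f set) \<le> card {0, p, q}"
    using sub by (rule card_mono[rotated]) simp
  then have "card (UNIV :: 'f set) \<le> 3"
    by (rule order_trans) (simp add: card_insert_if)
  ultimately obtain y where y: "\<And>c. y \<noteq> c *s w"
    using not_generated_by_one by metis
  have decomp: "x - (P.B x a / P.B w a) *s w \<in> {0, k}" for x
    using few[of "x - (P.B x a / P.B w a) *s w"] w
    by (auto simp: P.polar_sym[of a] P.polar_diff_left P.polar_scale_left)
  then have "k = y - (P.B y a / P.B w a) *s w"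
    using y[of "P.B y a / P.B w a"] by auto
  then have "P.B k a = 0"
    using w by (simp add: P.polar_diff_left P.polar_scale_left)
  then have "c *s k \<in> {0, k}" for c
    using few[of "c *s k"] by (auto simp: P.polar_sym[of a] P.polar_scale_left)
  then have "c = 0 \<or> c = 1" for c :: 'f
    using \<open>k \<noteq> 0\<close> P.scale_right_imp_eq[of k c 1] by auto
  then have "(UNIV :: 'f set) = {0, 1}"
    by auto
  then obtain x where x: "\<And>c d. x \<noteq> c *s w + d *s k"
    using not_generated_by_two by metis
  obtain d where "x - d *s w \<in> {0, k}"
    using decomp by blast
  then show False
    using x[of d 0] x[of d 1] by (auto simp: diff_eq_eq add.commute)
qed

lemma Q_nondegenerate: "nondegenerate_polar_form UNIV Q"
  unfolding nondegenerate_polar_form_def using polar_nonzero radical_trivial by blast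

text \<open>
  By proportionality of the polar forms at \<open>a\<close>, a vector isotropic for one form only would lie in
  the radical of one of them.
\<close>

lemma isotropic_iff: "Q a = 0 \<longleftrightarrow> P a = 0"
proof
  assume "Q a = 0"
  show "P a = 0"
  proof (rule ccontr)
    assume "P a \<noteq> 0"
    then have "Q.B x a = 0" for x
      using polar_proportional[of a x] \<open>Q a = 0\<close> by simp
    then have "a \<in> radical UNIV Q"
      using Q.polar_sym[of a] by (simp add: Q.radical_iff)
    then show False
      using Q_nondegenerate \<open>P a \<noteq> 0\<close> P.form_zero by (auto simp: nondegenerate_polar_form_def)
  qed
next
  assume "P a = 0"
  show "Q a = 0"
  proof (rule ccontr)
    assume "Q a \<noteq> 0"
    then have "a \<noteq> 0"
      using Q.form_zero by auto
    then have "a \<notin> radical UNIV Q"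
      using Q_nondegenerate by (auto simp: nondegenerate_polar_form_def)
    then have "P.B x a = 0" for x
      using polar_proportional'[of a x] \<open>Q a \<noteq> 0\<close> \<open>P a = 0\<close> by simp
    then show False
      using P_nondegenerate[OF \<open>a \<noteq> 0\<close>] by blast
  qed
qed

lemma polar_ratio: "P a \<noteq> 0 \<Longrightarrow> Q.B x a = (Q a / P a) * P.B x a"
  using polar_proportional[of a x] by (simp add: eq_divide_eq mult.commute)

text \<open>
  If \<open>a\<close> and \<open>b\<close> are not orthogonal, evaluate the polar form of \<open>Q\<close> at \<open>(a, b)\<close> in two ways. If they
  are orthogonal and \<open>a + b\<close> is isotropic, then it is so for both forms, and \<open>P a = - P b\<close>,
  \<open>Q a = - Q b\<close>. Otherwise \<open>a\<close>, \<open>b\<close> and \<open>a + b\<close> are eigenvectors of \<open>D\<^sub>P\<^sup>-\<^sup>1 \<circ> D\<^sub>Q\<close>, and then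
  \<open>a\<close> and \<open>b\<close> are linearly dependent or have the same eigenvalue.
\<close>

lemma ratio_constant:
  assumes a: "P a \<noteq> 0" and b: "P b \<noteq> 0"
  shows "Q a / P a = Q b / P b"
proof (cases "P.B a b = 0")
  case False
  have "(Q a / P a) * P.B a b = (Q b / P b) * P.B a b"
    using polar_ratio[OF a, of b] polar_ratio[OF b, of a] P.polar_sym[of a b] Q.polar_sym[of a b]
    by simp
  then show ?thesis
    using False by (metis mult_right_cancel)
next
  case True
  then have "Q.B a b = 0"
    using polar_ratio[OF b, of a] by simp
  show ?thesis
  proof (cases "P (a + b) = 0")
    case True
    then have "P a = - P b" "Q a = - Q b"
      using isotropic_iff[of "a + b"] \<open>P.B a b = 0\<close> \<open>Q.B a b = 0\<close>
      by (simp_all add: P.form_add Q.form_add eq_neg_iff_add_eq_0)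
    then show ?thesis by simp
  next
    case False
    define c where "c = Q (a + b) / P (a + b)"
    define u v where "u = Q a / P a - c" and "v = Q b / P b - c"
    have "P.B x (u *s a + v *s b) = 0" for x
      using polar_ratio[OF False, of x] polar_ratio[OF a, of x] polar_ratio[OF b, of x]
      by (simp add: P.polar_add_right Q.polar_add_right P.polar_scale_right u_def v_def
          flip: c_def) (simp add: algebra_simps)
    then have uv: "u *s a + v *s b = 0"
      using P_nondegenerate by blast
    show ?thesis
    proof (cases "u = 0")
      case True
      then have "v = 0"
        using uv b P.form_zero by auto
      then show ?thesis
        using True by (simp add: u_def v_def)
    next
      case False
      then have "a = (- v / u) *s b"
      proof -
        have "(1 / u) *s (u *s a + v *s b) = 0"
          by (simp add: uv)
        then have "a + (v / u) *s b = 0"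
          using False by (simp add: P.scale_right_distrib)
        then show ?thesis
          by (simp add: eq_neg_iff_add_eq_0)
      qed
      then obtain m where "a = m *s b" by blast
      then show ?thesis
        using a P.form_zero by (auto simp: P.form_scale Q.form_scale)
    qed
  qed
qed

theorem forms_proportional:
  obtains c where "c \<noteq> 0" "\<And>x. Q x = c * P x"
proof -
  obtain a where a: "P a \<noteq> 0"
    by (rule anisotropic_exists)
  have "Q x = (Q a / P a) * P x" for x
    using ratio_constant[OF a, of x] isotropic_iff[of x] a
    by (cases "P x = 0") (auto simp: field_simps)
  moreover have "Q a / P a \<noteq> 0"
    using a isotropic_iff by simp
  ultimately show thesis
    using that by blast
qed

end

section \<open>The dual space\<close>

lemma dual_spaceD:
  assumes "vector_space s" "a \<in> dual_space s"
  shows "a (x + y) = a x + a y" "a (s c x) = c * a x"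
  using assms by (auto simp: dual_space_iff)

lemma dual_space_comp:
  assumes "vector_space s" "a \<in> dual_space s" "\<phi> \<in> general_linear s UNIV"
  shows "a \<circ> \<phi> \<in> dual_space s"
  using assms by (auto simp: dual_space_iff general_linear_def)

lemma dual_space_comp_surj:
  assumes "vector_space s" "a \<in> dual_space s" "\<phi> \<in> general_linear s UNIV"
  obtains b where "b \<in> dual_space s" "a = b \<circ> \<phi>"
  using bij_betw_transpose_map[OF assms(1,3)] assms(2)
  by (auto simp: bij_betw_def transpose_map_def)

context finite_dimensional_vector_space
begin

text \<open>
  The bilinear form for which the basis is orthonormal. It identifies the space with its dual, so
  that a form on the dual space can be pulled back to the space itself.
\<close>

definition coordinate_form :: "'b \<Rightarrow> 'b \<Rightarrow> 'a" where
  "coordinate_form x y =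
     (\<Sum>e\<in>Basis. representation Basis x e * representation Basis y e)"

lemma coordinate_form_sym: "coordinate_form x y = coordinate_form y x"
  by (simp add: coordinate_form_def mult.commute)

lemma coordinate_form_add: "coordinate_form (x + y) = coordinate_form x + coordinate_form y"
  by (rule ext) (simp add: coordinate_form_def representation_add[OF independent_Basis]
      span_Basis distrib_right sum.distrib)

lemma coordinate_form_scale: "coordinate_form (scale c x) = (\<lambda>y. c * coordinate_form x y)"
  by (rule ext) (simp add: coordinate_form_def representation_scale[OF independent_Basis]
      span_Basis sum_distrib_left mult.assoc)

lemma coordinate_form_dual: "coordinate_form x \<in> dual_space scale"
  unfolding dual_space_iff[OF vector_space_axioms] coordinate_form_sym[of x]
  by (simp add: coordinate_form_add coordinate_form_scale)

lemma coordinate_form_basis: "e \<in> Basis \<Longrightarrow> coordinate_form x e = representation Basis x e"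
  by (simp add: coordinate_form_def representation_basis[OF independent_Basis] if_distrib
      finite_Basis cong: if_cong)

lemma bij_betw_coordinate_form: "bij_betw coordinate_form UNIV (dual_space scale)"
proof (rule bij_betwI')
  have expand: "x = (\<Sum>e\<in>Basis. scale (representation Basis x e) e)" for x
    using sum_representation_eq[OF independent_Basis, of x Basis] finite_Basis span_Basis by simp
  show "coordinate_form x = coordinate_form y \<longleftrightarrow> x = y" for x y
  proof
    assume "coordinate_form x = coordinate_form y"
    then have "representation Basis x e = representation Basis y e" if "e \<in> Basis" for e
      using coordinate_form_basis[OF that] by metis
    then have "(\<Sum>e\<in>Basis. scale (representation Basis x e) e) =
        (\<Sum>e\<in>Basis. scale (representation Basis y e) e)"
      by (intro sum.cong) auto
    then show "x = y"
      using expand by metis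
  qed simp
  show "\<exists>x\<in>UNIV. a = coordinate_form x" if a: "a \<in> dual_space scale" for a
  proof -
    define x where "x = (\<Sum>e\<in>Basis. scale (a e) e)"
    interpret vector_space_pair scale "(*) :: 'a \<Rightarrow> 'a \<Rightarrow> 'a"
      by (intro vector_space_pair.intro vector_space_axioms vector_space_times)
    have "representation Basis x e = a e" if "e \<in> Basis" for e
      using that finite_Basis
      by (simp add: x_def representation_sum[OF independent_Basis] span_Basis
          representation_scale[OF independent_Basis] representation_basis[OF independent_Basis]
          if_distrib cong: if_cong)
    then have "a y = coordinate_form x y" for y
      using a coordinate_form_basis coordinate_form_dual[of x]
      by (intro linear_eq_on[of a "coordinate_form x" y Basis])
        (auto simp: dual_space_def span_Basis)
    then show ?thesis by blast
  qed
qed (rule coordinate_form_dual)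

lemma dual_separates_points:
  assumes "\<And>a. a \<in> dual_space scale \<Longrightarrow> a x = a y"
  shows "x = y"
proof -
  have "coordinate_form x z = coordinate_form y z" for z
    using assms[OF coordinate_form_dual, of z] coordinate_form_sym by simp
  then have "coordinate_form x = coordinate_form y"
    by (rule ext)
  then show ?thesis
    using bij_betw_coordinate_form by (auto simp: bij_betw_def inj_on_def)
qed

text \<open>
  This reverses the passage from a form \<open>P\<close> to \<open>P \<circ> D\<^sub>P\<^sup>-\<^sup>1\<close>. Let \<open>E v\<close> be the functional that
  represents evaluation at \<open>v\<close> with respect to the polar form of \<open>R\<close>, and put \<open>P v = R (E v)\<close>.
  The polar form of \<open>P\<close> at \<open>(v, w)\<close> is that of \<open>R\<close> at \<open>(E v, E w)\<close>, which is \<open>E w v\<close>; by symmetry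
  \<open>D\<^sub>P = E\<close>.
\<close>

lemma form_on_dual_from_polar_form:
  fixes R :: "('b \<Rightarrow> 'a) \<Rightarrow> 'a"
  assumes R: "quadratic_form_on (\<lambda>c a x. c * a x) (dual_space scale) R"
    and nd: "nondegenerate_polar_form (dual_space scale) R"
  obtains P where "quadratic_form_on scale UNIV P" "nondegenerate_polar_form UNIV P"
    "\<And>v. R (polar_form P v) = P v"
proof -
  define j where "j = coordinate_form"
  note j_rules = coordinate_form_add coordinate_form_scale
  have j_dual: "j x \<in> dual_space scale" and j_sym: "j x y = j y x"
    and j_add: "j (x + y) = j x + j y" and j_sc: "j (scale c x) = (\<lambda>y. c * j x y)" for x y c
    unfolding j_def by (rule coordinate_form_dual coordinate_form_sym j_rules)+
  have j_bij: "bij_betw j UNIV (dual_space scale)"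
    unfolding j_def by (rule bij_betw_coordinate_form)
  have j_surj: "\<exists>x. a = j x" if "a \<in> dual_space scale" for a
    using j_bij that by (auto simp: bij_betw_def)
  have j_zero: "j x = 0 \<longleftrightarrow> x = 0" for x
    using j_bij j_add[of 0 0] unfolding bij_betw_def inj_def by (metis add_cancel_right_right)
  have polar_j: "polar_form (R \<circ> j) x y = polar_form R (j x) (j y)" for x y
    by (simp add: polar_form_def j_add)
  have q: "quadratic_form_on scale UNIV (R \<circ> j)"
    using R j_dual by (simp add: quadratic_form_on_def polar_j j_add j_sc)
  have "nondegenerate_polar_form UNIV (R \<circ> j)"
    unfolding nondegenerate_polar_form_def
  proof (intro equalityI subsetI)
    fix x assume "x \<in> radical UNIV (R \<circ> j)"
    then have "polar_form R (j x) (j y) = 0" for y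
      by (simp add: radical_def polar_j)
    then have "j x \<in> radical (dual_space scale) R"
      using j_surj j_dual by (fastforce simp: radical_def)
    then show "x \<in> {0}"
      using nd j_zero by (simp add: nondegenerate_polar_form_def)
  next
    have "0 \<in> radical (dual_space scale) R"
      using nd by (simp add: nondegenerate_polar_form_def)
    then show "x \<in> {0} \<Longrightarrow> x \<in> radical UNIV (R \<circ> j)" for x
      using j_dual j_zero[of 0] by (simp add: radical_def polar_j)
  qed
  \<comment> \<open>The evaluation at \<open>v\<close>, pulled back along \<open>j\<close>, is \<open>j v\<close>, since \<open>j\<close> is symmetric. Hence
    \<open>E = j \<circ> K\<^sup>-\<^sup>1 \<circ> j\<close>.\<close>
  define K where "K = polar_form (R \<circ> j)"
  have K_bij: "bij_betw K UNIV (dual_space scale)"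
    unfolding K_def by (rule bij_betw_polar_form) (fact finite_dimensional_vector_space_axioms q \<open>nondegenerate_polar_form UNIV (R \<circ> j)\<close>)+
  have K_add: "K (x + y) = K x + K y" and K_sc: "K (scale c x) = (\<lambda>y. c * K x y)" for x y c
    using q by (auto simp: K_def quadratic_form_on_def)
  define L where "L v = inv K (j v)" for v
  have KL: "K (L v) = j v" for v
    using K_bij j_dual by (simp add: L_def bij_betw_def f_inv_into_f)
  have K_inj: "K x = K y \<Longrightarrow> x = y" for x y
    using K_bij by (auto simp: bij_betw_def inj_def)
  have L_add: "L (v + w) = L v + L w" for v w
    by (rule K_inj) (simp add: KL K_add j_add)
  have L_sc: "L (scale c v) = scale c (L v)" for c v
    by (rule K_inj) (simp add: KL K_sc j_sc)
  define E where "E v = j (L v)" for v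
  have E_dual: "E v \<in> dual_space scale" for v
    by (simp add: E_def j_dual)
  have RE: "polar_form R (E v) (j y) = j y v" for v y
    using KL[of v] by (simp add: E_def K_def polar_j[symmetric] j_sym)
  define P where "P v = R (E v)" for v
  have E_add: "E (v + w) = E v + E w" for v w
    by (simp add: E_def L_add j_add)
  have "polar_form P v w = E w v" for v w
    using RE[of v "L w"] by (simp add: polar_form_def P_def E_add flip: E_def)
  moreover have polar_P_sym: "polar_form P v w = polar_form P w v" for v w
    by (simp add: polar_form_def algebra_simps)
  ultimately have polar_P: "polar_form P v = E v" for v
    by (metis ext)
  show thesis
  proof
    show "R (polar_form P v) = P v" for v
      by (simp add: polar_P P_def)
    have "E (scale c v) = (\<lambda>y. c * E v y)" for c v
      by (simp add: E_def L_sc j_sc)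
    moreover have "R (\<lambda>y. c * E v y) = c\<^sup>2 * R (E v)" for c v
      using R E_dual by (simp add: quadratic_form_on_def)
    moreover have "E v (x + y) = E v x + E v y" "E v (scale c x) = c * E v x" for v x y c
      using dual_spaceD[OF vector_space_axioms E_dual] by auto
    ultimately show "quadratic_form_on scale UNIV P"
      unfolding quadratic_form_on_def polar_P by (simp add: P_def E_add)
    have "v = 0" if "E v = 0" for v
      using that KL[of v] K_add[of 0 0] j_zero by (simp add: E_def)
    moreover have "E 0 = 0"
      using E_add[of 0 0] by simp
    ultimately show "nondegenerate_polar_form UNIV P"
      unfolding nondegenerate_polar_form_def radical_def polar_P
      by (auto simp: fun_eq_iff)
  qed
qed

end

section \<open>The representation of motions on the pair space\<close>

text \<open>
  Since the linear part acts by its inverse transpose, evaluating at \<open>b \<circ> \<phi>\<close> avoids all inverses.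
\<close>

lemma affine_rep_comp:
  assumes "vector_space s" "\<phi> \<in> general_linear s UNIV" "b \<in> dual_space s"
  shows "affine_rep s (\<lambda>x. t + \<phi> x) (a0, b \<circ> \<phi>) = (a0 - b t, b)"
proof -
  have "inv_into (dual_space s) (transpose_map \<phi>) (b \<circ> \<phi>) = b"
    using bij_betw_inv_into_left[OF bij_betw_transpose_map[OF assms(1,2)] assms(3)]
    by (simp add: transpose_map_def)
  then show ?thesis
    using dual_space_comp[OF assms(1,3,2)] affine_parts[OF assms(2), of t]
    by (simp add: affine_rep_def pair_space_def)
qed

lemma id_general_linear: "(\<lambda>x. x) \<in> general_linear s UNIV"
  by (simp add: general_linear_def bij_betw_def)

lemma translation_in_weak_motion_group: "(\<lambda>x. t + x) \<in> weak_motion_group s Q"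
  using id_general_linear[of s] affine_parts(1)[OF id_general_linear, of t]
  by (auto simp: weak_motion_group_def affine_group_def weak_orthogonal_group_def
      orthogonal_group_def)

lemma affine_rep_translation:
  assumes "vector_space s" "a \<in> dual_space s"
  shows "affine_rep s (\<lambda>x. t + x) (a0, a) = (a0 - a t, a)"
  using affine_rep_comp[OF assms(1) id_general_linear assms(2), of t a0] by (simp add: comp_def)

lemma zero_in_dual_space: "vector_space s \<Longrightarrow> 0 \<in> dual_space s"
  by (simp add: dual_space_iff)

lemma affine_rep_fixes_unit:
  assumes "vector_space s" "\<gamma> \<in> affine_group s"
  shows "affine_rep s \<gamma> (a0, 0) = (a0, 0)"
proof -
  obtain \<phi> t where phi: "\<phi> \<in> general_linear s UNIV" and "\<gamma> = (\<lambda>x. t + \<phi> x)"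
    using assms(2) by (auto simp: affine_group_def)
  then show ?thesis
    using affine_rep_comp[OF assms(1) phi zero_in_dual_space[OF assms(1)], of t a0]
    by (simp add: comp_def zero_fun_def)
qed

context finite_dimensional_vector_space
begin

lemma affine_rep_determines_linear_part:
  assumes \<phi>: "\<phi> \<in> general_linear scale UNIV" and \<psi>: "\<psi> \<in> general_linear scale UNIV"
    and eq: "affine_rep scale (\<lambda>x. t + \<phi> x) = affine_rep scale (\<lambda>x. u + \<psi> x)"
  shows "\<phi> = \<psi>"
proof
  fix x
  show "\<phi> x = \<psi> x"
  proof (rule dual_separates_points)
    fix b assume b: "b \<in> dual_space scale"
    have "b \<circ> \<phi> \<in> dual_space scale"
      using vector_space_axioms b \<phi> by (rule dual_space_comp)
    then obtain c where c: "c \<in> dual_space scale" "b \<circ> \<phi> = c \<circ> \<psi>"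
      using vector_space_axioms \<psi> by (metis dual_space_comp_surj)
    have "(0 - b t, b) = (0 - c u, c)"
      using affine_rep_comp[OF vector_space_axioms \<phi> b, of t 0, unfolded eq c(2)]
        affine_rep_comp[OF vector_space_axioms \<psi> c(1), of u 0]
      by (rule trans[OF sym])
    then show "b (\<phi> x) = b (\<psi> x)"
      using c(2) by (simp add: fun_eq_iff)
  qed
qed

text \<open>
  The isomorphism \<open>D\<^sub>P\<close> from \<open>V\<close> to its dual turns \<open>\<phi>\<close> into its inverse transpose, that is,
  \<open>D\<^sub>P (\<phi> v) \<circ> \<phi> = D\<^sub>P v\<close>, for all isometries \<open>\<phi>\<close> of \<open>P\<close> and also for all \<open>\<phi>\<close> whose transpose
  preserves \<open>R\<close>. So \<open>\<phi>\<close> is an isometry of \<open>P\<close> if and only if its image under the representation is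
  one of \<open>Qt\<close>. This image fixes the radical of \<open>Qt\<close>, and it determines \<open>\<phi>\<close>.
\<close>

lemma orthogonal_group_via_representation:
  fixes R P Qt
  assumes P: "quadratic_form_on scale UNIV P" "nondegenerate_polar_form UNIV P"
    and RP: "\<And>v. R (polar_form P v) = P v"
    and Qt: "\<And>a0 a. a \<in> dual_space scale \<Longrightarrow> Qt (a0, a) = R a"
    and rad: "radical (pair_space scale) Qt = UNIV \<times> {0}"
    and H: "H \<subseteq> general_linear scale UNIV"
    and image: "affine_rep scale ` {\<gamma> \<in> affine_group scale. linear_part \<gamma> \<in> H} =
      weak_orthogonal_group pair_scale (pair_space scale) Qt"
  shows "orthogonal_group scale UNIV P = H"
proof (intro equalityI subsetI)
  note vs = vector_space_axioms
  have E_bij: "bij_betw (polar_form P) UNIV (dual_space scale)"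
    using finite_dimensional_vector_space_axioms P by (rule bij_betw_polar_form)
  have E_dual: "polar_form P v \<in> dual_space scale" for v
    using E_bij by (auto simp: bij_betw_def)
  have E_surj: "\<exists>v. b = polar_form P v" if "b \<in> dual_space scale" for b
    using E_bij that by (auto simp: bij_betw_def)
  have E_add: "polar_form P (v + w) = polar_form P v + polar_form P w" for v w
    using P(1) by (auto simp: quadratic_form_on_def)
  have polar_sym: "polar_form P v w = polar_form P w v" for v w
    by (simp add: polar_form_def algebra_simps)
  have R_pairing: "polar_form R (polar_form P v) b = b v" if "b \<in> dual_space scale" for v b
  proof -
    obtain w where w: "b = polar_form P w"
      using E_surj \<open>b \<in> dual_space scale\<close> by blast
    have "polar_form R (polar_form P v) (polar_form P w) = polar_form P v w"
      unfolding polar_form_def[of R] by (simp add: RP polar_form_def[of P v w] flip: E_add)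
    then show ?thesis
      using w polar_sym by simp
  qed
  {
    fix \<phi> assume \<phi>: "\<phi> \<in> orthogonal_group scale UNIV P"
    then have gl: "\<phi> \<in> general_linear scale UNIV" and pres: "P (\<phi> v) = P v"
      and add: "\<phi> (v + w) = \<phi> v + \<phi> w" for v w
      by (auto simp: orthogonal_group_def general_linear_def)
    have aff: "(\<lambda>x. 0 + \<phi> x) \<in> affine_group scale"
      using gl unfolding affine_group_def by blast
    have "polar_form P (\<phi> v) \<circ> \<phi> = polar_form P v" for v
      by (simp add: fun_eq_iff polar_form_def pres flip: add)
    then have rep: "affine_rep scale (\<lambda>x. 0 + \<phi> x) (a0, polar_form P v) = (a0, polar_form P (\<phi> v))"
      for a0 v
      using affine_rep_comp[OF vs gl E_dual[of "\<phi> v"], of 0 a0]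
        dual_spaceD(2)[OF vs E_dual, of _ 0] by (metis diff_zero mult_zero_left scale_zero_left)
    have "affine_rep scale (\<lambda>x. 0 + \<phi> x) \<in> weak_orthogonal_group pair_scale (pair_space scale) Qt"
      unfolding weak_orthogonal_group_def orthogonal_group_def
    proof (intro CollectI conjI ballI)
      show "affine_rep scale (\<lambda>x. 0 + \<phi> x) \<in> general_linear pair_scale (pair_space scale)"
        using vs aff by (rule affine_rep_in_general_linear)
      show "Qt (affine_rep scale (\<lambda>x. 0 + \<phi> x) w) = Qt w" if "w \<in> pair_space scale" for w
        using that E_surj[of "snd w"] by (auto simp: pair_space_def rep Qt E_dual RP pres simp del: add_0)
      show "affine_rep scale (\<lambda>x. 0 + \<phi> x) w = w" if "w \<in> radical (pair_space scale) Qt" for w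
        using that affine_rep_fixes_unit[OF vs aff] unfolding rad by auto
    qed
    then obtain \<gamma> where \<gamma>: "\<gamma> \<in> affine_group scale" "linear_part \<gamma> \<in> H"
      and eq: "affine_rep scale (\<lambda>x. 0 + \<phi> x) = affine_rep scale \<gamma>"
      unfolding image[symmetric] by blast
    obtain \<psi> t where \<psi>: "\<psi> \<in> general_linear scale UNIV" "\<gamma> = (\<lambda>x. t + \<psi> x)"
      using \<gamma>(1) by (auto simp: affine_group_def)
    have "\<phi> = \<psi>"
      using gl \<psi>(1) eq unfolding \<psi>(2) by (rule affine_rep_determines_linear_part)
    then show "\<phi> \<in> H"
      using \<gamma>(2) affine_parts(1)[OF \<psi>(1)] \<psi>(2) by simp
  next
    fix \<phi> assume \<phi>: "\<phi> \<in> H"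
    then have gl: "\<phi> \<in> general_linear scale UNIV"
      using H by blast
    then have "(\<lambda>x. 0 + \<phi> x) \<in> affine_group scale" "linear_part (\<lambda>x. 0 + \<phi> x) = \<phi>"
      using affine_parts(1)[OF gl, of 0] unfolding affine_group_def by blast+
    then have "affine_rep scale (\<lambda>x. 0 + \<phi> x) \<in> weak_orthogonal_group pair_scale (pair_space scale) Qt"
      unfolding image[symmetric] using \<phi> by (intro imageI) simp
    then have Qt_pres: "Qt (affine_rep scale (\<lambda>x. 0 + \<phi> x) (0, a)) = Qt (0, a)" if "a \<in> dual_space scale" for a
      using that by (simp add: weak_orthogonal_group_def orthogonal_group_def pair_space_def del: add_0)
    have R_pres: "R (b \<circ> \<phi>) = R b" if b: "b \<in> dual_space scale" for b
      using Qt_pres[OF dual_space_comp[OF vs b gl]] affine_rep_comp[OF vs gl b, of 0 0]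
        Qt[OF b] Qt[OF dual_space_comp[OF vs b gl]] by (simp del: add_0)
    have polar_R_pres: "polar_form R (b \<circ> \<phi>) (c \<circ> \<phi>) = polar_form R b c"
      if "b \<in> dual_space scale" "c \<in> dual_space scale" for b c
    proof -
      have "b + c \<in> dual_space scale"
        using that by (auto simp: dual_space_iff[OF vs] algebra_simps)
      moreover have "(b \<circ> \<phi>) + (c \<circ> \<phi>) = (b + c) \<circ> \<phi>"
        by auto
      ultimately show ?thesis
        using that by (simp add: polar_form_def R_pres)
    qed
    have "polar_form P (\<phi> v) \<circ> \<phi> = polar_form P v" for v
    proof -
      obtain u where u: "polar_form P (\<phi> v) \<circ> \<phi> = polar_form P u"
        using E_surj dual_space_comp[OF vs E_dual gl] by blast
      have "\<phi> u = \<phi> v"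
      proof (rule dual_separates_points)
        fix b assume b: "b \<in> dual_space scale"
        show "b (\<phi> u) = b (\<phi> v)"
          using polar_R_pres[OF E_dual b, of "\<phi> v"] R_pairing[OF b, of "\<phi> v"]
            R_pairing[OF dual_space_comp[OF vs b gl], of u] unfolding u by simp
      qed
      then have "u = v"
        using gl by (auto simp: general_linear_def bij_betw_def inj_def)
      then show ?thesis
        using u by simp
    qed
    then have "P (\<phi> v) = P v" for v
      using R_pres[OF E_dual[of "\<phi> v"]] RP by metis
    then show "\<phi> \<in> orthogonal_group scale UNIV P"
      using gl by (simp add: orthogonal_group_def)
  }
qed

end

section \<open>Forms invariant under translations\<close>

text \<open>
  Both groups of motions contain all translations, so this is what the two cases of the hypothesis
  on \<open>Qt\<close> have in common.
\<close>

locale translation_invariant_form = finite_dimensional_vector_space scale Basis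
  for scale :: "'f::field \<Rightarrow> 'v::ab_group_add \<Rightarrow> 'v" and Basis :: "'v set" +
  fixes Qt :: "'f \<times> ('v \<Rightarrow> 'f) \<Rightarrow> 'f"
  assumes quadratic: "quadratic_form_on pair_scale (pair_space scale) Qt"
    and translation_isometry: "\<And>t. affine_rep scale (\<lambda>x. t + x) \<in>
      weak_orthogonal_group pair_scale (pair_space scale) Qt"
    and not_point: "dim UNIV \<noteq> 0"
    and not_small_line: "\<not> (dim UNIV = 1 \<and> finite (UNIV :: 'f set) \<and> card (UNIV :: 'f set) \<le> 3)"
begin

definition unit :: "'f \<times> ('v \<Rightarrow> 'f)" where "unit = (1, 0)"

definition dual_form :: "('v \<Rightarrow> 'f) \<Rightarrow> 'f" where "dual_form a = Qt (0, a)"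

lemma mem_pair_space: "(a0, a) \<in> pair_space scale \<longleftrightarrow> a \<in> dual_space scale"
  by (simp add: pair_space_def)

lemma unit_mem: "unit \<in> pair_space scale"
  by (simp add: unit_def mem_pair_space zero_in_dual_space vector_space_axioms)

lemma dual_space_add: "a \<in> dual_space scale \<Longrightarrow> b \<in> dual_space scale \<Longrightarrow> a + b \<in> dual_space scale"
  by (auto simp: dual_space_iff[OF vector_space_axioms] algebra_simps)

lemma dual_space_scale: "a \<in> dual_space scale \<Longrightarrow> (\<lambda>x. c * a x) \<in> dual_space scale"
  by (auto simp: dual_space_iff[OF vector_space_axioms] algebra_simps)

lemma Qt_zero: "Qt 0 = 0"
proof -
  have "pair_scale 0 unit = 0"
    by (simp add: unit_def pair_scale_apply zero_prod_def zero_fun_def)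
  moreover have "Qt (pair_scale 0 unit) = 0\<^sup>2 * Qt unit"
    using quadratic unit_mem unfolding quadratic_form_on_def by blast
  ultimately show ?thesis by simp
qed

lemma Qt_expand:
  assumes "a \<in> dual_space scale"
  shows "Qt (a0, a) = a0\<^sup>2 * Qt unit + a0 * polar_form Qt unit (0, a) + Qt (0, a)"
proof -
  have pair: "(a0, a) = pair_scale a0 unit + (0, a)"
    by (simp add: unit_def pair_scale_apply zero_fun_def fun_eq_iff)
  have "Qt (pair_scale a0 unit + (0, a)) =
      Qt (pair_scale a0 unit) + Qt (0, a) + polar_form Qt (pair_scale a0 unit) (0, a)"
    by (simp add: polar_form_def)
  also have "\<dots> = a0\<^sup>2 * Qt unit + Qt (0, a) + a0 * polar_form Qt unit (0, a)"
    using quadratic assms unit_mem by (simp add: quadratic_form_on_def mem_pair_space)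
  finally show ?thesis
    unfolding pair by simp
qed

text \<open>
  A suitable translation maps \<open>(a0, a)\<close> to \<open>(0, a)\<close>.
\<close>

lemma Qt_translate:
  assumes "a \<in> dual_space scale" "a \<noteq> 0"
  shows "a0\<^sup>2 * Qt unit + a0 * polar_form Qt unit (0, a) = 0"
proof -
  obtain y where y: "a y \<noteq> 0"
    using assms(2) by (auto simp: fun_eq_iff)
  have "a (scale (a0 / a y) y) = a0"
    using y dual_spaceD(2)[OF vector_space_axioms assms(1)] by simp
  then have "Qt (0, a) = Qt (a0, a)"
    using translation_isometry[of "scale (a0 / a y) y"] assms(1)
      affine_rep_translation[OF vector_space_axioms assms(1), of "scale (a0 / a y) y" a0]
    by (auto simp: weak_orthogonal_group_def orthogonal_group_def mem_pair_space
        dest!: bspec[where x = "(a0, a)"])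
  then show ?thesis
    using Qt_expand[OF assms(1), of a0] by simp
qed

text \<open>
  Otherwise the coordinate form would embed \<open>V\<close> into \<open>{0, a}\<close>.
\<close>

lemma dual_not_single:
  assumes "a \<noteq> 0" "dim UNIV \<noteq> 1"
  obtains b where "b \<in> dual_space scale" "b \<noteq> 0" "b \<noteq> a"
proof (rule ccontr)
  assume "\<not> thesis"
  then have only: "b = 0 \<or> b = a" if "b \<in> dual_space scale" for b
    using that \<open>\<And>b. b \<in> dual_space scale \<Longrightarrow> b \<noteq> 0 \<Longrightarrow> b \<noteq> a \<Longrightarrow> thesis\<close> by blast
  have inj: "coordinate_form x = coordinate_form y \<Longrightarrow> x = y" for x y
    using bij_betw_coordinate_form by (auto simp: bij_betw_def inj_def)
  have zero: "coordinate_form 0 = 0"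
    using coordinate_form_add[of 0 0] by simp
  have to_a: "coordinate_form x = a" if "x \<noteq> 0" for x
    using only[OF coordinate_form_dual, of x] inj[of x 0] zero that by auto
  define v :: 'v where "v = (SOME x. x \<noteq> 0)"
  have v: "x = 0 \<or> x = v" for x
  proof (cases "x = 0")
    case False
    then have "v \<noteq> 0"
      unfolding v_def by (rule someI)
    then show ?thesis
      using to_a[OF False] to_a[of v] inj[of x v] by simp
  qed simp
  have "x \<in> span {v}" for x
    using v[of x] span_base[of v "{v}"] span_zero by auto
  then have "UNIV \<subseteq> span {v}"
    by blast
  then have "dim UNIV \<le> card {v}"
    by (rule dim_le_card) simp
  then have "dim UNIV \<le> 1"
    by (simp only: card.insert card.empty finite.emptyI empty_iff not_False_eq_True One_nat_def)
  then show False
    using not_point assms(2) by linarith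
qed

lemma nonzero_functional:
  obtains a where "a \<in> dual_space scale" "a \<noteq> 0"
proof -
  have "\<not> (UNIV :: 'v set) \<subseteq> {0}"
    using not_point by (simp only: dim_eq_0 not_False_eq_True)
  then obtain x :: 'v where "x \<noteq> 0"
    by auto
  then obtain a where "a \<in> dual_space scale" "a x \<noteq> a 0"
    using dual_separates_points by blast
  moreover from this have "a \<noteq> 0"
    by auto
  ultimately show thesis
    using that by blast
qed

text \<open>
  The preceding identity, a polynomial identity of degree 2 in \<open>a0\<close>, forces \<open>Qt unit = 0\<close> unless
  \<open>F\<close> has only two elements. In that case it says that the functional \<open>polar_form Qt unit (0, \<cdot>)\<close> takes
  the value \<open>- Qt unit\<close> at each of the non-zero functionals \<open>d\<close>, \<open>b\<close> and \<open>d + b\<close>; these exist in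
  dimension at least 2.
\<close>

lemma Qt_unit: "Qt unit = 0"
proof (rule ccontr)
  assume nz: "Qt unit \<noteq> 0"
  obtain a where a: "a \<in> dual_space scale" "a \<noteq> 0"
    by (rule nonzero_functional)
  have polar: "polar_form Qt unit (0, b) = - Qt unit" if "b \<in> dual_space scale" "b \<noteq> 0" for b
    using Qt_translate[OF that, of 1] by (simp add: eq_neg_iff_add_eq_0 add.commute)
  have "c = 0 \<or> c = 1" for c :: 'f
    using Qt_translate[OF a, of c] polar[OF a] nz by (simp add: power2_eq_square)
  then have two: "(UNIV :: 'f set) = {0, 1}"
    by auto
  have "finite (UNIV :: 'f set)" "card (UNIV :: 'f set) \<le> 3"
    unfolding two by auto
  then have "dim UNIV \<noteq> 1"
    using not_small_line by blast
  then obtain b where b: "b \<in> dual_space scale" "b \<noteq> 0" "b \<noteq> a"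
    using dual_not_single[OF a(2)] by blast
  define d where "d = a + (\<lambda>x. - 1 * b x)"
  have "d \<in> dual_space scale"
    unfolding d_def using a(1) b(1) by (intro dual_space_add dual_space_scale)
  moreover have d_plus: "a = d + b"
    by (simp add: d_def fun_eq_iff)
  then have "d \<noteq> 0"
    using b(3) by auto
  ultimately have d: "d \<in> dual_space scale" "d \<noteq> 0" .
  have "(0, d) \<in> pair_space scale" "(0, b) \<in> pair_space scale"
    using b(1) d(1) by (simp_all add: mem_pair_space)
  then have "polar_form Qt unit ((0, d) + (0, b)) =
      polar_form Qt unit (0, d) + polar_form Qt unit (0, b)"
    using quadratic unit_mem unfolding quadratic_form_on_def by blast
  then have "polar_form Qt unit (0, a) = polar_form Qt unit (0, d) + polar_form Qt unit (0, b)"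
    by (simp add: d_plus)
  then have "- Qt unit = - Qt unit + - Qt unit"
    by (simp only: polar[OF a] polar[OF b(1,2)] polar[OF d])
  then show False
    using nz by (metis add_cancel_right_right neg_equal_0_iff_equal)
qed

lemma Qt_eq_dual_form: "a \<in> dual_space scale \<Longrightarrow> Qt (a0, a) = dual_form a"
proof -
  assume a: "a \<in> dual_space scale"
  have "polar_form Qt unit (0, a) = 0"
  proof (cases "a = 0")
    case True
    then show ?thesis
      by (simp add: polar_form_def Qt_zero flip: zero_prod_def)
  next
    case False
    then show ?thesis
      using Qt_translate[OF a, of 1] Qt_unit by simp
  qed
  then show ?thesis
    using Qt_expand[OF a, of a0] Qt_unit by (simp add: dual_form_def)
qed

lemma polar_Qt:
  "a \<in> dual_space scale \<Longrightarrow> b \<in> dual_space scale \<Longrightarrow>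
    polar_form Qt (a0, a) (b0, b) = polar_form dual_form a b"
  by (simp add: polar_form_def Qt_eq_dual_form dual_space_add)

lemma quadratic_dual_form: "quadratic_form_on (\<lambda>c a x. c * a x) (dual_space scale) dual_form"
proof -
  have eq: "dual_form a = Qt (0, a)" "polar_form dual_form a b = polar_form Qt (0, a) (0, b)"
    "(0 :: 'f, a + b) = (0, a) + (0, b)" "(0 :: 'f, \<lambda>x. c * a x) = pair_scale c (0, a)" for a b c
    by (simp_all add: dual_form_def polar_form_def pair_scale_apply)
  have q: "x \<in> pair_space scale \<Longrightarrow> Qt (pair_scale c x) = c\<^sup>2 * Qt x"
    "x \<in> pair_space scale \<Longrightarrow> y \<in> pair_space scale \<Longrightarrow> z \<in> pair_space scale \<Longrightarrow>
      polar_form Qt (x + y) z = polar_form Qt x z + polar_form Qt y z"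
    "x \<in> pair_space scale \<Longrightarrow> y \<in> pair_space scale \<Longrightarrow> z \<in> pair_space scale \<Longrightarrow>
      polar_form Qt x (y + z) = polar_form Qt x y + polar_form Qt x z"
    "x \<in> pair_space scale \<Longrightarrow> y \<in> pair_space scale \<Longrightarrow>
      polar_form Qt (pair_scale c x) y = c * polar_form Qt x y"
    "x \<in> pair_space scale \<Longrightarrow> y \<in> pair_space scale \<Longrightarrow>
      polar_form Qt x (pair_scale c y) = c * polar_form Qt x y" for x y z c
    using quadratic unfolding quadratic_form_on_def by blast+
  show ?thesis
    unfolding quadratic_form_on_def eq
    by (intro conjI allI ballI; rule q; simp add: mem_pair_space)
qed

text \<open>
  A radical vector \<open>a\<close> of the dual form gives the radical vector \<open>(0, a)\<close> of \<open>Qt\<close>. It is fixed by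
  all translations, so \<open>a\<close> vanishes everywhere.
\<close>

lemma nondegenerate_dual_form: "nondegenerate_polar_form (dual_space scale) dual_form"
  unfolding nondegenerate_polar_form_def
proof (intro equalityI subsetI)
  fix a assume rad: "a \<in> radical (dual_space scale) dual_form"
  then have a: "a \<in> dual_space scale"
    by (simp add: radical_def)
  have "(0, a) \<in> radical (pair_space scale) Qt"
    using rad by (auto simp: radical_def pair_space_def polar_Qt)
  then have "affine_rep scale (\<lambda>x. t + x) (0, a) = (0, a)" for t
    using translation_isometry[of t] by (auto simp: weak_orthogonal_group_def)
  then show "a \<in> {0}"
    using affine_rep_translation[OF vector_space_axioms a, of _ 0] by (simp add: fun_eq_iff)
next
  fix a :: "'v \<Rightarrow> 'f" assume "a \<in> {0}"
  moreover have "Qt (0, 0) = 0"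
    using Qt_eq_dual_form[of 0 1] Qt_unit zero_in_dual_space[OF vector_space_axioms]
    by (simp add: dual_form_def unit_def)
  ultimately show "a \<in> radical (dual_space scale) dual_form"
    using zero_in_dual_space[OF vector_space_axioms]
    by (simp add: radical_def polar_form_def dual_form_def)
qed

lemma radical_Qt: "radical (pair_space scale) Qt = UNIV \<times> {0}"
proof -
  have "(a0, a) \<in> radical (pair_space scale) Qt \<longleftrightarrow> a \<in> radical (dual_space scale) dual_form" for a0 a
    by (auto simp: radical_def pair_space_def polar_Qt)
  then show ?thesis
    using nondegenerate_dual_form by (auto simp: nondegenerate_polar_form_def)
qed

end

text \<open>
  In dimension 0 there are only trivial motions. A form \<open>Qt \<noteq> 0\<close> on the line \<open>F \<times> {0}\<close> would have
  radical \<open>0\<close> since the characteristic is not 2, and \<open>- 1\<close> would be a weak isometry moving \<open>(1, 0)\<close>.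
\<close>

lemma form_on_pair_space_over_point:
  fixes s :: "'f::field \<Rightarrow> 'v::ab_group_add \<Rightarrow> 'v"
  assumes vs: "vector_space s" and point: "(UNIV :: 'v set) = {0}" and odd_char: "(2 :: 'f) \<noteq> 0"
    and Qt: "quadratic_form_on pair_scale (pair_space s) Qt"
    and fix_unit: "\<And>\<psi>. \<psi> \<in> weak_orthogonal_group pair_scale (pair_space s) Qt \<Longrightarrow> \<psi> (1, 0) = (1, 0)"
    and "w \<in> pair_space s"
  shows "Qt w = 0"
proof -
  have "(a :: 'v \<Rightarrow> 'f) = 0" if "a \<in> dual_space s" for a
  proof
    fix x :: 'v
    have "x = 0"
      using UNIV_I[of x] unfolding point by simp
    then show "a x = 0 x"
      using dual_spaceD(1)[OF vs that, of 0 0] by (metis add_cancel_right_right zero_fun_apply)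
  qed
  then have W: "pair_space s = UNIV \<times> {0 :: 'v \<Rightarrow> 'f}"
    using zero_in_dual_space[OF vs] by (auto simp: pair_space_def)
  have Qt_mult: "Qt (c, 0) = c\<^sup>2 * Qt (1, 0)" for c
  proof -
    have "(c, 0 :: 'v \<Rightarrow> 'f) = pair_scale c (1, 0)"
      by (simp add: pair_scale_apply zero_fun_def)
    moreover have "Qt (pair_scale c (1, 0)) = c\<^sup>2 * Qt (1, 0)"
      using Qt by (simp add: quadratic_form_on_def W)
    ultimately show ?thesis by simp
  qed
  have "Qt (1, 0) = 0"
  proof (rule ccontr)
    assume nz: "Qt (1, 0) \<noteq> 0"
    define \<psi> where "\<psi> = (\<lambda>w \<in> pair_space s. - w)"
    have "bij_betw \<psi> (pair_space s) (pair_space s)"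
      by (rule bij_betwI[where g = \<psi>]) (auto simp: \<psi>_def W)
    moreover have "- pair_scale c w = pair_scale c (- w)" for c and w :: "'f \<times> ('v \<Rightarrow> 'f)"
      by (cases w) (simp add: pair_scale_apply fun_eq_iff)
    ultimately have "\<psi> \<in> general_linear pair_scale (pair_space s)"
      by (auto simp: general_linear_def \<psi>_def W pair_scale_apply fun_eq_iff)
    moreover have "Qt (\<psi> w) = Qt w" if "w \<in> pair_space s" for w
      using that Qt_mult[of "fst w"] Qt_mult[of "- fst w"] by (auto simp: \<psi>_def W)
    moreover have "\<psi> w = w" if rad: "w \<in> radical (pair_space s) Qt" for w
    proof -
      obtain c where c: "w = (c, 0)" "polar_form Qt (c, 0) (1, 0) = 0"
        using rad by (auto simp: radical_def W)
      have "polar_form Qt (c, 0) (1, 0) = ((c + 1)\<^sup>2 - c\<^sup>2 - 1) * Qt (1, 0)"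
        using Qt_mult[of "c + 1"] Qt_mult[of c] by (simp add: polar_form_def algebra_simps)
      also have "(c + 1)\<^sup>2 - c\<^sup>2 - 1 = 2 * c"
        by (simp add: power2_eq_square algebra_simps)
      finally have "2 * c * Qt (1, 0) = 0"
        using c(2) by (rule trans[OF sym])
      then have "c = 0"
        using nz odd_char by (metis mult_eq_0_iff)
      then show ?thesis
        using c(1) by (simp add: \<psi>_def W)
    qed
    ultimately have "\<psi> (1, 0) = (1, 0)"
      by (intro fix_unit) (simp add: weak_orthogonal_group_def orthogonal_group_def)
    then have "(- 1 :: 'f) = 1"
      by (simp add: \<psi>_def W)
    then show False
      using odd_char by (metis add.right_inverse one_add_one)
  qed
  then show ?thesis
    using assms(6) Qt_mult[of "fst w"] by (auto simp: W)
qed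

theorem theorem5p9:
  fixes scale :: "'f::field \<Rightarrow> 'v::ab_group_add \<Rightarrow> 'v"
    and Basis :: "'v set"
    and Q :: "'v \<Rightarrow> 'f"
    and Qt :: "'f \<times> ('v \<Rightarrow> 'f) \<Rightarrow> 'f"
  assumes "finite_dimensional_vector_space scale Basis"
    and "quadratic_form_on scale UNIV Q"
    and "quadratic_form_on pair_scale (pair_space scale) Qt"
    and "affine_rep scale ` motion_group scale Q
           = weak_orthogonal_group pair_scale (pair_space scale) Qt
         \<or> affine_rep scale ` weak_motion_group scale Q
           = weak_orthogonal_group pair_scale (pair_space scale) Qt"
    and "\<not> (vector_space.dim scale (UNIV :: 'v set) = 0 \<and> CHAR('f) = 2)"
    and "\<not> (vector_space.dim scale (UNIV :: 'v set) = 1 \<and> finite (UNIV :: 'f set) \<and> card (UNIV :: 'f set) \<le> 3)"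
    and "\<not> (vector_space.dim scale (UNIV :: 'v set) = 2 \<and> card (UNIV :: 'f set) = 2)"
  shows "nondegenerate_polar_form UNIV Q \<and>
    (\<exists>c. c \<noteq> 0 \<and> (\<forall>w\<in>pair_space scale. Qt w = c * lifted_form Q w))"
proof -
  interpret finite_dimensional_vector_space scale Basis by fact
  note vs = vector_space_axioms
  obtain H where H: "H = orthogonal_group scale UNIV Q \<or> H = weak_orthogonal_group scale UNIV Q"
    and image: "affine_rep scale ` {\<gamma> \<in> affine_group scale. linear_part \<gamma> \<in> H} =
      weak_orthogonal_group pair_scale (pair_space scale) Qt"
    using assms(4) unfolding motion_group_def weak_motion_group_def by blast
  show ?thesis
  proof (cases "dim UNIV = 0")
    case True
    then have point: "(UNIV :: 'v set) = {0}"
      by (simp only: dim_eq_0) auto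
    have "\<not> CHAR('f) dvd 2"
    proof
      assume div: "CHAR('f) dvd 2"
      then have "CHAR('f) \<le> 2"
        by (rule dvd_imp_le) simp
      moreover have "CHAR('f) \<noteq> 0"
        using div by (metis dvd_0_left_iff zero_neq_numeral)
      moreover have "CHAR('f) \<noteq> 1"
        using CHAR_not_1'[where 'a = 'f] by simp
      ultimately show False
        using True assms(5) by linarith
    qed
    then have "(2 :: 'f) \<noteq> 0"
      by (metis of_nat_eq_0_iff_char_dvd of_nat_numeral)
    have "\<psi> (1, 0) = (1, 0)" if "\<psi> \<in> weak_orthogonal_group pair_scale (pair_space scale) Qt" for \<psi>
      using that affine_rep_fixes_unit[OF vs] unfolding image[symmetric] by blast
    then have "Qt w = 0" if "w \<in> pair_space scale" for w
      using form_on_pair_space_over_point[OF vs point \<open>2 \<noteq> 0\<close> assms(3) _ that] by blast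
    moreover have Q0: "Q x = 0" for x
    proof -
      have "x = 0"
        using UNIV_I[of x] unfolding point by simp
      then show ?thesis
        using assms(2) unfolding quadratic_form_on_def
        by (metis UNIV_I mult_zero_left scale_zero_left zero_power2)
    qed
    then have "lifted_form Q w = 0" for w
      by (simp add: lifted_form_def split_beta)
    moreover have "nondegenerate_polar_form UNIV Q"
      using point by (auto simp: nondegenerate_polar_form_def radical_def polar_form_def Q0)
    ultimately show ?thesis
      by (intro conjI exI[of _ 1]) auto
  next
    case False
    have translation: "affine_rep scale (\<lambda>x. t + x) \<in> weak_orthogonal_group pair_scale (pair_space scale) Qt" for t
      using translation_in_weak_motion_group[of t scale Q] H unfolding image[symmetric]
      by (auto simp: weak_motion_group_def weak_orthogonal_group_def)
    interpret T: translation_invariant_form scale Basis Qt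
      using assms(3,6) translation False by unfold_locales
    obtain P where P: "quadratic_form_on scale UNIV P" "nondegenerate_polar_form UNIV P"
      and RP: "\<And>v. T.dual_form (polar_form P v) = P v"
      using form_on_dual_from_polar_form[OF T.quadratic_dual_form T.nondegenerate_dual_form] by blast
    have "H \<subseteq> general_linear scale UNIV"
      using H by (auto simp: weak_orthogonal_group_def orthogonal_group_def)
    then have "orthogonal_group scale UNIV P = H"
      using orthogonal_group_via_representation[OF P RP T.Qt_eq_dual_form T.radical_Qt]
        image by blast
    then interpret forms_with_same_isometries scale Basis P Q
      using P assms H False by unfold_locales auto
    obtain c where c: "c \<noteq> 0" "\<And>x. Q x = c * P x"
      using forms_proportional by blast
    have polar_Q: "polar_form Q x y = c * polar_form P x y" for x y
      by (simp add: polar_form_def c(2) algebra_simps)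
    have inj: "inj (polar_form Q)"
      using bij_betw_polar_form[OF assms(1,2) Q_nondegenerate] by (simp add: bij_betw_def)
    have "Qt w = c * lifted_form Q w" if mem: "w \<in> pair_space scale" for w
    proof -
      obtain a0 a where w: "w = (a0, a)" "a \<in> dual_space scale"
        using mem by (auto simp: pair_space_def)
      then obtain v where v: "a = polar_form P v"
        using bij_betw_polar_form[OF assms(1) P] by (auto simp: bij_betw_def)
      have "polar_form Q (scale (1 / c) v) = a"
        by (rule ext) (simp add: polar_Q P.polar_scale_left v c(1))
      \<comment> \<open>Hence \<open>Qt = c * lifted_form Q\<close>: the argument is scaled by \<open>1 / c\<close> and the form by \<open>c\<close>.\<close>
      then have "inv (polar_form Q) a = scale (1 / c) v"
        using inj by (metis inv_f_f)
      then have "lifted_form Q w = P v / c"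
        using c by (simp add: w lifted_form_def P.form_scale power2_eq_square)
      then show ?thesis
        using c(1) w v T.Qt_eq_dual_form RP by simp
    qed
    then show ?thesis
      using c(1) Q_nondegenerate by blast
  qed
qed

end
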